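(* For $0<k<1$, $$\int_0^1\left(\frac{f(-q^5)}{f(-q)}\right)^{-6k+5} f(-q)^4\,q^{-k}\,dq=11^{k-1}\,\pi\csc(k\pi)\;{}_2F_1\!\left[\begin{matrix}\tfrac12-\tfrac k2,\;1-\tfrac k2\\ 1\end{matrix};-\frac{4}{121}\right].$$
   Context: For $0<q<1$, $f(-q)=\prod_{n\ge1}(1-q^n)$. ${}_2F_1\!\left[\begin{matrix}a,b\\c\end{matrix};x\right]=\sum_{j\ge0}\frac{(a)_j(b)_j}{(c)_j}\frac{x^j}{j!}$ is the Gauss hypergeometric function, with $(a)_j$ the Pochhammer symbol. *)

theory Defs
  imports "HOL-Analysis.Analysis"
begin

text \<open>
  Ramanujan's one-variable theta function, normalised so that
  \<open>ramanujan_f (-q) = (1 - q) (1 - q\<^sup>2) (1 - q\<^sup>3) \<dots>\<close>. The argument carries the minus sign,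
  and the library's \<open>prodinf\<close> is indexed from 0, hence the shift. It is meant for \<open>\<bar>x\<bar> < 1\<close>.
\<close>

definition ramanujan_f :: "real \<Rightarrow> real" where
  "ramanujan_f x = (\<Prod>n. 1 - (- x) ^ Suc n)"

lemma ramanujan_f_minus: "ramanujan_f (- q) = (\<Prod>n. 1 - q ^ Suc n)"
  by (simp add: ramanujan_f_def)

text \<open>
  The library only has the generalised hypergeometric series as a formal power series; its third
  argument is a scaling factor of the variable, here 1.
\<close>

definition hypergeo_2F1 :: "real \<Rightarrow> real \<Rightarrow> real \<Rightarrow> real \<Rightarrow> real" where
  "hypergeo_2F1 a b c x = eval_fps (fps_hypergeo [a, b] [c] 1) x"

lemma hypergeo_2F1_eq_suminf:
  "hypergeo_2F1 a b c x =
     (\<Sum>j. pochhammer a j * pochhammer b j / pochhammer c j * (x ^ j / fact j))"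
  by (simp add: hypergeo_2F1_def eval_fps_def)

definition csc :: "real \<Rightarrow> real" where
  "csc x = 1 / sin x"

end

theory Submission
  imports Defs "HOL-Real_Asymp.Real_Asymp"
begin

text \<open>
  Put \<open>E(q) = f(-q)\<close> and \<open>u = q (E(q\<^sup>5) / E(q))\<^sup>6\<close>. The integrand is \<open>u\<^sup>-\<^sup>k E(q\<^sup>5)\<^sup>5 / E(q)\<close>, and the
  differential equation \<open>du/dq = (E(q\<^sup>5)\<^sup>5 / E(q)) sqrt ((1 + 11 u)\<^sup>2 + 4 u\<^sup>2)\<close> turns the integral into
  the integral of \<open>u\<^sup>-\<^sup>k / sqrt ((1 + 11 u)\<^sup>2 + 4 u\<^sup>2)\<close> over \<open>u > 0\<close>. With \<open>w = 11 u / (1 + 11 u)\<close> and the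
  binomial series this becomes a series of Beta integrals.

  The differential equation is proved with theta functions of squared nome \<open>q\<^sup>5\<close> at the 5-torsion points
  \<open>q\<close> and \<open>q\<^sup>2\<close>. The addition formula for \<open>\<theta>(x + y) \<theta>(x - y)\<close> yields, by differentiation, two weight one
  Eisenstein series \<open>a\<close>, \<open>b\<close> that are products of theta values; the heat equation then gives, for
  \<open>v = b / a = R(q)\<^sup>5\<close> with the Rogers-Ramanujan continued fraction \<open>R\<close>, that
  \<open>4 q v' / v = a\<^sup>2 - 11 a b - b\<^sup>2\<close> and \<open>4 q u' / u = a\<^sup>2 + b\<^sup>2\<close>. Hence \<open>(1 / v - 11 - v) u\<close> is constant, and it
  tends to 1 as \<open>q\<close> tends to 0. As \<open>a b = 4 q E(q\<^sup>5)\<^sup>5 / E(q)\<close> and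
  \<open>(1 / v + v)\<^sup>2 = (1 / v - v)\<^sup>2 + 4\<close>, the differential equation for \<open>u\<close> follows.
\<close>

text \<open>The addition formula is a determinant \<open>[w(x), w(y)]\<close> of one plane vector
  \<open>w\<close> made of two theta series. Its derivatives are determinants of \<open>w\<close>
  and its derivatives, so relations usually drawn from Liouville's theorem on elliptic functions
  become Pluecker relations, which are polynomial identities on the real line.

  The obstacle is the derivative of \<open>u\<close>. By the heat equation it involves the third
  derivative of theta at 0, which is not a theta value at a 5-torsion point. The duplication formula
  of the Weierstrass function contains the same quantity, and adding its instances at the two
  torsion points eliminates it.

  The constant 4/121 comes from
  \<open>(1 + 11 u)^2 + 4 u^2 = (1 + 11 u)^2 (1 + (4/121) w^2)\<close>. As \<open>w\<close> stays
  below 1, the binomial series converges uniformly on the whole range of integration, which a series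
  in powers of \<open>u\<close> would not do.\<close>

section \<open>Gaussian sums over the integers\<close>

text \<open>This class is stable under the polynomial factors that differentiation produces, and the
  Gaussian still dominates it.\<close>

definition exp_bounded :: "(int \<Rightarrow> real) \<Rightarrow> bool" where
  "exp_bounded c \<longleftrightarrow> (\<exists>K B. \<forall>n. \<bar>c n\<bar> \<le> K * exp (B * \<bar>real_of_int n\<bar>))"

definition gsum :: "(int \<Rightarrow> real) \<Rightarrow> real \<Rightarrow> real \<Rightarrow> real" where
  "gsum c t z = (\<Sum>\<^sub>\<infinity>n. c n * exp (z * of_int n - t * (of_int n)\<^sup>2))"

lemma exp_bounded_of_bounded: "(\<And>n. \<bar>c n\<bar> \<le> K) \<Longrightarrow> exp_bounded c"
  unfolding exp_bounded_def by (intro exI[of _ K] exI[of _ 0]) simp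

lemma exp_bounded_mult:
  assumes "exp_bounded c" "exp_bounded d"
  shows "exp_bounded (\<lambda>n. c n * d n)"
proof -
  from assms obtain K B L C where
    c: "\<And>n. \<bar>c n\<bar> \<le> K * exp (B * \<bar>real_of_int n\<bar>)" and
    d: "\<And>n. \<bar>d n\<bar> \<le> L * exp (C * \<bar>real_of_int n\<bar>)"
    unfolding exp_bounded_def by metis
  have "\<bar>c n * d n\<bar> \<le> (K * L) * exp ((B + C) * \<bar>real_of_int n\<bar>)" for n
    using mult_mono[OF c d, of n n] order_trans[OF abs_ge_zero c[of n]]
    by (simp add: abs_mult ring_distribs exp_add mult_ac)
  thus ?thesis unfolding exp_bounded_def by blast
qed

lemma exp_bounded_of_int: "exp_bounded (\<lambda>n. of_int n)"
proof -
  have "\<bar>x\<bar> \<le> 1 * exp (1 * \<bar>x\<bar>)" for x :: real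
    using exp_ge_add_one_self[of "\<bar>x\<bar>"] by (simp del: exp_ge_add_one_self)
  thus ?thesis unfolding exp_bounded_def by blast
qed

lemma exp_bounded_const: "exp_bounded (\<lambda>n. x)"
  by (rule exp_bounded_of_bounded[of _ "\<bar>x\<bar>"]) simp

lemma exp_bounded_add:
  assumes "exp_bounded c" "exp_bounded d"
  shows "exp_bounded (\<lambda>n. c n + d n)"
proof -
  from assms obtain K B L C where
    c: "\<And>n. \<bar>c n\<bar> \<le> K * exp (B * \<bar>real_of_int n\<bar>)" and
    d: "\<And>n. \<bar>d n\<bar> \<le> L * exp (C * \<bar>real_of_int n\<bar>)"
    unfolding exp_bounded_def by metis
  have K: "K \<ge> 0" and L: "L \<ge> 0"
    using order_trans[OF abs_ge_zero c[of 0]] order_trans[OF abs_ge_zero d[of 0]] by auto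
  have "\<bar>c n + d n\<bar> \<le> (K + L) * exp (max B C * \<bar>real_of_int n\<bar>)" for n
  proof -
    have "K * exp (B * \<bar>real_of_int n\<bar>) \<le> K * exp (max B C * \<bar>real_of_int n\<bar>)"
      using K by (intro mult_left_mono) (auto intro!: mult_right_mono)
    moreover have "L * exp (C * \<bar>real_of_int n\<bar>) \<le> L * exp (max B C * \<bar>real_of_int n\<bar>)"
      using L by (intro mult_left_mono) (auto intro!: mult_right_mono)
    ultimately show ?thesis using c[of n] d[of n] unfolding distrib_right by linarith
  qed
  thus ?thesis unfolding exp_bounded_def by blast
qed

lemma exp_bounded_power: "exp_bounded c \<Longrightarrow> exp_bounded (\<lambda>n. c n ^ k)"
  by (induction k) (auto intro: exp_bounded_const exp_bounded_mult)

lemma summable_on_exp_neg_abs: "(\<lambda>n::int. exp (- \<bar>real_of_int n\<bar>)) summable_on UNIV"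
proof -
  have nat: "(\<lambda>n::nat. exp (- real n)) summable_on UNIV"
  proof (rule norm_summable_imp_summable_on)
    have "(\<lambda>n::nat. exp (-1::real) ^ n) sums (1 / (1 - exp (-1)))"
      by (rule geometric_sums) simp
    moreover have "exp (-1::real) ^ n = exp (- real n)" for n
      by (simp add: exp_of_nat_mult[symmetric])
    ultimately show "summable (\<lambda>n::nat. norm (exp (- real n)))"
      by (simp add: sums_iff)
  qed
  have 1: "(\<lambda>n::int. exp (- \<bar>real_of_int n\<bar>)) summable_on range int"
    by (subst summable_on_reindex) (use nat in \<open>auto simp: o_def\<close>)
  have 2: "(\<lambda>n::int. exp (- \<bar>real_of_int n\<bar>)) summable_on range (\<lambda>n. - int n)"
    by (subst summable_on_reindex) (use nat in \<open>auto simp: o_def inj_on_def\<close>)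
  have "range int \<union> range (\<lambda>n. - int n) = UNIV"
  proof -
    have "x \<in> range int \<union> range (\<lambda>n. - int n)" for x
      by (cases x rule: int_cases2) auto
    thus ?thesis by blast
  qed
  thus ?thesis using summable_on_union[OF 1 2] by simp
qed

text \<open>Completing the square absorbs every linear exponent into a constant. The majorant
  depends on \<open>t\<close> and \<open>z\<close> only through \<open>d\<close> and
  \<open>M\<close>, so it yields summability and also the uniform convergence behind termwise
  differentiation.\<close>

lemma exp_bounded_majorant:
  assumes "exp_bounded c" "d > 0"
  obtains D where "\<And>n t z. t \<ge> d \<Longrightarrow> \<bar>z\<bar> \<le> M \<Longrightarrow>
    \<bar>c n * exp (z * of_int n - t * (of_int n)\<^sup>2)\<bar> \<le> D * exp (- \<bar>real_of_int n\<bar>)"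
proof -
  from assms obtain K B where c: "\<And>n. \<bar>c n\<bar> \<le> K * exp (B * \<bar>real_of_int n\<bar>)"
    unfolding exp_bounded_def by metis
  have K: "K \<ge> 0"
    using order_trans[OF abs_ge_zero c[of 0]] by auto
  \<comment> \<open>\<open>B\<close> is the growth rate of \<open>c\<close>, \<open>M\<close> bounds
    \<open>z\<close>, and the extra 1 is what survives as the decay
    \<open>exp(-|n|)\<close>.\<close>
  define N where "N = B + M + 1"
  have "\<bar>c n * exp (z * of_int n - t * (of_int n)\<^sup>2)\<bar> \<le> K * exp (N\<^sup>2 / (4 * d)) * exp (- \<bar>real_of_int n\<bar>)"
    if t: "t \<ge> d" and z: "\<bar>z\<bar> \<le> M" for n t z
  proof -
    define x where "x = \<bar>real_of_int n\<bar>"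
    have "z * of_int n \<le> M * x"
      using abs_ge_self[of "z * of_int n"] mult_right_mono[OF z, of x] by (simp add: x_def abs_mult)
    moreover have "d * x\<^sup>2 \<le> t * (of_int n)\<^sup>2"
      unfolding x_def using t by (simp add: mult_right_mono)
    moreover have "N * x - d * x\<^sup>2 \<le> N\<^sup>2 / (4 * d)"
    proof -
      have "0 \<le> (N - 2 * d * x)\<^sup>2" by simp
      hence "4 * d * (N * x - d * x\<^sup>2) \<le> N\<^sup>2"
        by (simp add: power2_eq_square algebra_simps)
      thus ?thesis using \<open>d > 0\<close> by (simp add: field_simps)
    qed
    ultimately have *: "B * x + (z * of_int n - t * (of_int n)\<^sup>2) \<le> N\<^sup>2 / (4 * d) + - x"
      unfolding N_def by (simp add: algebra_simps)
    have "\<bar>c n * exp (z * of_int n - t * (of_int n)\<^sup>2)\<bar>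
        \<le> K * exp (B * x) * exp (z * of_int n - t * (of_int n)\<^sup>2)"
      unfolding abs_mult abs_exp_cancel by (intro mult_right_mono) (use c[of n] in \<open>auto simp: x_def\<close>)
    also have "\<dots> = K * exp (B * x + (z * of_int n - t * (of_int n)\<^sup>2))"
      by (simp only: exp_add mult.assoc)
    also have "\<dots> \<le> K * exp (N\<^sup>2 / (4 * d) + - x)"
      using * K by (intro mult_left_mono) auto
    also have "\<dots> = K * exp (N\<^sup>2 / (4 * d)) * exp (- \<bar>real_of_int n\<bar>)"
      by (simp only: exp_add mult.assoc x_def)
    finally show ?thesis .
  qed
  thus ?thesis by (rule that)
qed

lemma abs_summable_gsum:
  assumes "exp_bounded c" "t > 0"
  shows "(\<lambda>n. norm (c n * exp (z * of_int n - t * (of_int n)\<^sup>2))) summable_on UNIV"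
proof -
  obtain D where D: "\<And>n s y. s \<ge> t \<Longrightarrow> \<bar>y\<bar> \<le> \<bar>z\<bar> \<Longrightarrow>
    \<bar>c n * exp (y * of_int n - s * (of_int n)\<^sup>2)\<bar> \<le> D * exp (- \<bar>real_of_int n\<bar>)"
    using exp_bounded_majorant[OF assms, of "\<bar>z\<bar>"] by blast
  show ?thesis
  proof (rule Infinite_Sum.abs_summable_on_comparison_test')
    show "(\<lambda>n::int. D * exp (- \<bar>real_of_int n\<bar>)) summable_on UNIV"
      by (intro summable_on_cmult_right summable_on_exp_neg_abs)
  qed (use D[of t z] in auto)
qed

lemma summable_gsum:
  assumes "exp_bounded c" "t > 0"
  shows "(\<lambda>n. c n * exp (z * of_int n - t * (of_int n)\<^sup>2)) summable_on UNIV"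
  using abs_summable_summable[OF abs_summable_gsum[OF assms]] .

lemma has_sum_gsum:
  assumes "exp_bounded c" "t > 0"
  shows "((\<lambda>n. c n * exp (z * of_int n - t * (of_int n)\<^sup>2)) has_sum gsum c t z) UNIV"
  unfolding gsum_def using summable_gsum[OF assms] by (rule has_sum_infsum)

text \<open>Enumerating the integers turns summable families into series, the form in which termwise
  differentiation and Tannery's theorem apply.\<close>

lemma sums_int_decode:
  fixes f :: "int \<Rightarrow> real"
  assumes "(f has_sum S) UNIV"
  shows "(\<lambda>n. f (int_decode n)) sums S"
proof -
  have "((\<lambda>n. f (int_decode n)) has_sum S) UNIV"
    using assms by (subst has_sum_reindex_bij_betw[OF bij_int_decode])
  thus ?thesis by (rule has_sum_imp_sums)
qed

text \<open>Letting both parameters move on a line covers the derivative in \<open>z\<close> (case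
  \<open>a = 0\<close>) and the derivative along \<open>t = 5 s\<close>, \<open>z = 4 s\<close> at
  once.\<close>

lemma has_real_derivative_gsum:
  assumes c: "exp_bounded c" and pos: "A + a * s > 0"
  shows "((\<lambda>s. gsum c (A + a * s) (B + b * s)) has_real_derivative
           gsum (\<lambda>n. c n * (b * of_int n - a * (of_int n)\<^sup>2)) (A + a * s) (B + b * s)) (at s)"
proof -
  define c' where "c' = (\<lambda>n. c n * (b * of_int n + (- a) * (of_int n)\<^sup>2))"
  have c'_eq: "c' = (\<lambda>n. c n * (b * of_int n - a * (of_int n)\<^sup>2))" by (auto simp: c'_def)
  have c': "exp_bounded c'" unfolding c'_def
    by (intro exp_bounded_mult exp_bounded_add exp_bounded_power c exp_bounded_of_int exp_bounded_const)
  define d where "d = (A + a * s) / 2"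
  have d: "d > 0" using pos by (simp add: d_def)
  \<comment> \<open>This radius gives \<open>|a| * e <= d\<close>, so near \<open>s\<close> the
    Gaussian parameter keeps at least half of its value at \<open>s\<close>.\<close>
  define e where "e = d / (\<bar>a\<bar> + 1)"
  have e: "e > 0" using d by (simp add: e_def divide_pos_pos)
  define M where "M = \<bar>B + b * s\<bar> + \<bar>b\<bar> * e"
  define S where "S = ball s e"
  have S: "A + a * x \<ge> d" "\<bar>B + b * x\<bar> \<le> M" if "x \<in> S" for x
  proof -
    have x: "\<bar>x - s\<bar> \<le> e" using that by (simp add: S_def dist_real_def abs_minus_commute)
    have ae: "\<bar>a\<bar> * e \<le> d" unfolding e_def using d
      by (simp add: field_simps)
    have "\<bar>a * (x - s)\<bar> \<le> d" using mult_left_mono[OF x, of "\<bar>a\<bar>"] ae by (simp add: abs_mult)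
    hence "- (a * (x - s)) \<le> d" by (rule abs_le_D2)
    moreover have "A + a * x = 2 * d + a * (x - s)" by (simp add: d_def algebra_simps)
    ultimately show "A + a * x \<ge> d" by linarith
    have "\<bar>b * (x - s)\<bar> \<le> \<bar>b\<bar> * e" using mult_left_mono[OF x, of "\<bar>b\<bar>"] by (simp add: abs_mult)
    moreover have "B + b * x = (B + b * s) + b * (x - s)" by (simp add: algebra_simps)
    ultimately show "\<bar>B + b * x\<bar> \<le> M" unfolding M_def
      by (metis abs_triangle_ineq add_left_mono order_trans)
  qed
  define tm where "tm = (\<lambda>c n x. (c (int_decode n) :: real) * exp ((B + b * x) * of_int (int_decode n)
       - (A + a * x) * (of_int (int_decode n))\<^sup>2))"
  obtain D where D: "\<And>n t z. t \<ge> d \<Longrightarrow> \<bar>z\<bar> \<le> M \<Longrightarrow>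
    \<bar>c' n * exp (z * of_int n - t * (of_int n)\<^sup>2)\<bar> \<le> D * exp (- \<bar>real_of_int n\<bar>)"
    using exp_bounded_majorant[OF c' d, of M] by blast
  have sums: "(\<lambda>n. tm c n x) sums gsum c (A + a * x) (B + b * x)" 
    if "x \<in> S" "exp_bounded c" for x c
    using sums_int_decode[OF has_sum_gsum[OF that(2), of "A + a * x" "B + b * x"]] d S(1)[OF that(1)]
    by (simp add: tm_def)
  have s: "s \<in> S" using e by (simp add: S_def)
  have "((\<lambda>x. \<Sum>n. tm c n x) has_field_derivative (\<Sum>n. tm c' n s)) (at s)"
  proof (rule has_field_derivative_series'[where S = S])
    show "convex S" by (simp add: S_def)
    show "(tm c n has_real_derivative tm c' n x) (at x within S)" for n x
    proof -
      define m where "m = real_of_int (int_decode n)"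
      have "((\<lambda>x. c (int_decode n) * exp ((B + b * x) * m - (A + a * x) * m\<^sup>2)) has_real_derivative
          c (int_decode n) * (exp ((B + b * x) * m - (A + a * x) * m\<^sup>2) * (b * m - a * m\<^sup>2))) (at x)"
        by (rule derivative_eq_intros refl)+ simp
      from has_field_derivative_at_within[OF this, of S] show ?thesis
        by (simp add: tm_def c'_def m_def mult_ac)
    qed
    show "uniformly_convergent_on S (\<lambda>n x. \<Sum>i<n. tm c' i x)"
    proof (rule Weierstrass_m_test')
      show "norm (tm c' n x) \<le> D * exp (- \<bar>real_of_int (int_decode n)\<bar>)" if "x \<in> S" for n x
        using D[OF S[OF that]] by (simp add: tm_def)
      have "((\<lambda>n. D * exp (- \<bar>real_of_int n\<bar>)) has_sum (\<Sum>\<^sub>\<infinity>n. D * exp (- \<bar>real_of_int n\<bar>))) UNIV"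
        by (intro has_sum_infsum summable_on_cmult_right summable_on_exp_neg_abs)
      from sums_int_decode[OF this]
      show "summable (\<lambda>n. D * exp (- \<bar>real_of_int (int_decode n)\<bar>))" by (simp add: sums_iff)
    qed
    show "summable (\<lambda>n. tm c n s)" using sums[OF s c] by (simp add: sums_iff)
    show "s \<in> S" "s \<in> interior S" using e by (auto simp: S_def interior_open)
  qed
  hence "((\<lambda>x. \<Sum>n. tm c n x) has_field_derivative gsum c' (A + a * s) (B + b * s)) (at s)"
    using sums[OF s c'] by (simp add: sums_iff)
  hence "((\<lambda>x. gsum c (A + a * x) (B + b * x)) has_field_derivative
           gsum c' (A + a * s) (B + b * s)) (at s)"
  proof (rule has_field_derivative_transform_within_open)
    show "open S" by (simp add: S_def)
    show "(\<Sum>n. tm c n x) = gsum c (A + a * x) (B + b * x)" if "x \<in> S" for x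
      using sums[OF that c] by (rule sums_unique[symmetric])
  qed (rule s)
  thus ?thesis by (simp only: c'_eq)
qed

section \<open>The Jacobi triple product\<close>

definition euler_prod :: "real \<Rightarrow> real" where
  "euler_prod q = (\<Prod>n. 1 - q ^ Suc n)"

text \<open>The q-Pochhammer symbol \<open>(q; q)_n\<close>.\<close>

definition qfact :: "real \<Rightarrow> nat \<Rightarrow> real" where
  "qfact q n = (\<Prod>i<n. 1 - q ^ Suc i)"

lemma convergent_prod_one_minus_power:
  fixes q :: real
  assumes "0 < q" "q < 1"
  shows "convergent_prod (\<lambda>n. 1 - q ^ Suc n)"
proof (rule abs_convergent_prod_imp_convergent_prod, rule summable_imp_abs_convergent_prod)
  have "summable (\<lambda>n. q * q ^ n)"
    using assms by (intro summable_mult summable_geometric) auto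
  thus "summable (\<lambda>n. norm (1 - q ^ Suc n - 1))" using assms by simp
qed

lemma qfact_tendsto:
  assumes "0 < q" "q < 1"
  shows "qfact q \<longlonglongrightarrow> euler_prod q"
proof -
  have "(\<lambda>n. \<Prod>i\<le>n. 1 - q ^ Suc i) \<longlonglongrightarrow> euler_prod q"
    unfolding euler_prod_def by (rule convergent_prod_LIMSEQ[OF convergent_prod_one_minus_power[OF assms]])
  hence "(\<lambda>n. qfact q (Suc n)) \<longlonglongrightarrow> euler_prod q"
    by (simp add: qfact_def lessThan_Suc_atMost)
  thus ?thesis by (subst (asm) filterlim_sequentially_Suc)
qed

lemma one_minus_power_bounds:
  fixes q :: real
  assumes "0 < q" "q < 1"
  shows "0 < 1 - q ^ Suc n" "1 - q ^ Suc n < 1"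
  using assms power_Suc_less_one[of q n] by (auto simp del: power_Suc)

lemma qfact_pos: "0 < q \<Longrightarrow> q < 1 \<Longrightarrow> 0 < qfact q n"
  unfolding qfact_def by (intro prod_pos) (use one_minus_power_bounds in auto)

lemma qfact_le_1: "0 < q \<Longrightarrow> q < 1 \<Longrightarrow> qfact q n \<le> 1"
  unfolding qfact_def by (intro prod_le_1) (use one_minus_power_bounds in \<open>auto simp: less_imp_le\<close>)

lemma decseq_qfact: "0 < q \<Longrightarrow> q < 1 \<Longrightarrow> decseq (qfact q)"
proof (rule decseq_SucI)
  fix n assume q: "0 < q" "q < 1"
  have "qfact q (Suc n) = qfact q n * (1 - q ^ Suc n)" by (simp add: qfact_def)
  also have "\<dots> \<le> qfact q n * 1"
    using qfact_pos[OF q] one_minus_power_bounds[OF q] by (intro mult_left_mono) (auto simp: less_imp_le)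
  finally show "qfact q (Suc n) \<le> qfact q n" by simp
qed

lemma euler_prod_le_qfact: "0 < q \<Longrightarrow> q < 1 \<Longrightarrow> euler_prod q \<le> qfact q n"
  by (rule decseq_ge[OF decseq_qfact qfact_tendsto])

lemma euler_prod_le_1: "0 < q \<Longrightarrow> q < 1 \<Longrightarrow> euler_prod q \<le> 1"
  using euler_prod_le_qfact[of q 0] by (simp add: qfact_def)

lemma euler_prod_pos: 
  assumes "0 < q" "q < 1"
  shows "0 < euler_prod q"
proof -
  have "euler_prod q \<noteq> 0" unfolding euler_prod_def
  proof (rule prodinf_nonzero[OF convergent_prod_one_minus_power[OF assms]])
    show "1 - q ^ Suc i \<noteq> 0" for i using one_minus_power_bounds[OF assms, of i] by linarith
  qed
  moreover have "euler_prod q \<ge> 0"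
    by (rule LIMSEQ_le_const[OF qfact_tendsto[OF assms]]) (use qfact_pos[OF assms] in \<open>auto simp: less_imp_le\<close>)
  ultimately show ?thesis by linarith
qed

text \<open>The nonprincipal Dirichlet character modulo 4. It turns the sum over half-integers in
  Jacobi's theta function into a sum over all integers and supplies the alternating sign.\<close>

definition chi4 :: "int \<Rightarrow> real" where
  "chi4 n = (if n mod 4 = 1 then 1 else if n mod 4 = 3 then -1 else 0)"

lemma chi4_odd: "chi4 (2 * k + 1) = (if even k then 1 else -1)"
proof (cases "even k")
  case True
  then obtain j where "k = 2 * j" by (elim evenE)
  hence "(2 * k + 1) mod 4 = 1" by presburger
  thus ?thesis using True by (simp add: chi4_def)
next
  case False
  then obtain j where "k = 2 * j + 1" by (elim oddE)
  hence "(2 * k + 1) mod 4 = 3" by presburger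
  thus ?thesis using False by (simp add: chi4_def)
qed

lemma chi4_even: "even n \<Longrightarrow> chi4 n = 0"
proof -
  assume "even n"
  hence "n mod 4 \<noteq> 1 \<and> n mod 4 \<noteq> 3" by presburger
  thus ?thesis by (simp add: chi4_def)
qed

lemma chi4_minus: "chi4 (- n) = - chi4 n"
proof (cases "even n")
  case False
  then obtain j where j: "n = 2 * j + 1" by (elim oddE)
  hence "- n = 2 * (- j - 1) + 1" by simp
  hence "chi4 (- n) = (if even (- j - 1) then 1 else -1)" by (simp only: chi4_odd)
  thus ?thesis unfolding j chi4_odd by auto
qed (simp add: chi4_even)

lemma chi4_add_2: "chi4 (n + 2) = - chi4 n"
proof (cases "even n")
  case False
  then obtain j where j: "n = 2 * j + 1" by (elim oddE)
  hence "n + 2 = 2 * (j + 1) + 1" by simp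
  hence "chi4 (n + 2) = (if even (j + 1) then 1 else -1)" by (simp only: chi4_odd)
  thus ?thesis unfolding j chi4_odd by auto
qed (simp add: chi4_even)

text \<open>Up to a constant factor, \<open>theta t j z\<close> is the \<open>j\<close>-th derivative in \<open>z\<close> of Jacobi's \<open>\<theta>\<^sub>1\<close>, with
  \<open>exp (- 8 t)\<close> as the square of the nome and on the imaginary axis, where the series is real.\<close>

definition theta :: "real \<Rightarrow> nat \<Rightarrow> real \<Rightarrow> real" where
  "theta t j = gsum (\<lambda>n. chi4 n * of_int n ^ j) t"

lemma exp_bounded_chi4: "exp_bounded (\<lambda>n. chi4 n * of_int n ^ j)"
  by (intro exp_bounded_mult exp_bounded_power exp_bounded_of_int exp_bounded_of_bounded[of chi4 1])
     (auto simp: chi4_def)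

text \<open>The theta term at the odd integer \<open>n = 1 - 2 k\<close>. With this indexing the
  sign is \<open>(-1)^k\<close> and the finite triple product occupies the symmetric range from
  \<open>-n\<close> to \<open>n\<close>.\<close>

definition odd_term :: "real \<Rightarrow> real \<Rightarrow> int \<Rightarrow> real" where
  "odd_term t z k = (if even k then 1 else -1) * exp (z * (1 - 2 * of_int k) - t * (1 - 2 * of_int k)\<^sup>2)"

lemma has_sum_odd_term:
  assumes "t > 0"
  shows "((\<lambda>k. odd_term t z k * (1 - 2 * of_int k) ^ j) has_sum theta t j z) UNIV"
proof -
  define f where "f = (\<lambda>n. chi4 n * of_int n ^ j * exp (z * of_int n - t * (of_int n)\<^sup>2))"
  have "(f has_sum theta t j z) UNIV"
    unfolding f_def theta_def by (rule has_sum_gsum[OF exp_bounded_chi4 assms])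
  hence "(f has_sum theta t j z) (range (\<lambda>k. 1 - 2 * k))"
  proof (subst (asm) has_sum_cong_neutral[where g = f and T = "range (\<lambda>k. 1 - 2 * k)"])
    fix n assume "n \<in> UNIV - range (\<lambda>k::int. 1 - 2 * k)"
    moreover have "n = 1 - 2 * ((1 - n) div 2)" if "odd n" using that by presburger
    ultimately have "even n" by blast
    thus "f n = 0" by (simp add: f_def chi4_even)
  qed auto
  hence "((f \<circ> (\<lambda>k. 1 - 2 * k)) has_sum theta t j z) UNIV"
    by (subst (asm) has_sum_reindex) (auto simp: inj_on_def)
  moreover have "(f \<circ> (\<lambda>k. 1 - 2 * k)) = (\<lambda>k. odd_term t z k * (1 - 2 * of_int k) ^ j)"
  proof
    fix k :: int
    have "1 - 2 * k = 2 * (- k) + 1" by simp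
    hence "chi4 (1 - 2 * k) = (if even (- k) then 1 else -1)" by (simp only: chi4_odd)
    thus "(f \<circ> (\<lambda>k. 1 - 2 * k)) k = odd_term t z k * (1 - 2 * of_int k) ^ j"
      by (auto simp: f_def odd_term_def)
  qed
  ultimately show ?thesis by simp
qed

lemma odd_term_minus_1:
  "odd_term t z (k - 1) = - odd_term t z k * exp (2 * z) * exp (- 8 * t * (1 - of_int k))"
  unfolding odd_term_def by (simp add: exp_add[symmetric] power2_eq_square algebra_simps)

lemma odd_term_plus_1:
  "odd_term t z (k + 1) = - odd_term t z k * exp (- 2 * z) * exp (- 8 * t * of_int k)"
  unfolding odd_term_def by (simp add: exp_add[symmetric] power2_eq_square algebra_simps)

text \<open>With the value 0 at negative integers, \<open>rqfact_minus_1\<close> has no boundary cases.\<close>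

definition rqfact :: "real \<Rightarrow> int \<Rightarrow> real" where
  "rqfact q m = (if m < 0 then 0 else 1 / qfact q (nat m))"

lemma rqfact_minus_1:
  assumes "t > 0"
  shows "rqfact (exp (- 8 * t)) (m - 1) = (1 - exp (- 8 * t * of_int m)) * rqfact (exp (- 8 * t)) m"
proof (cases "m > 0")
  case True
  define n where "n = nat (m - 1)"
  have m: "m = int (Suc n)" using True by (simp add: n_def)
  have q: "0 < exp (- 8 * t)" "exp (- 8 * t) < 1" using assms by auto
  have "exp (- 8 * t * of_int m) = exp (- 8 * t) ^ Suc n"
    unfolding m exp_of_nat_mult[symmetric] by (simp add: algebra_simps)
  moreover have "qfact (exp (- 8 * t)) (Suc n) = qfact (exp (- 8 * t)) n * (1 - exp (- 8 * t) ^ Suc n)"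
    by (simp add: qfact_def)
  moreover have "1 - exp (- 8 * t) ^ Suc n \<noteq> 0" using one_minus_power_bounds[OF q, of n] by linarith
  ultimately show ?thesis using True qfact_pos[OF q, of n]
    by (simp add: rqfact_def m nat_add_distrib del: power_Suc)
next
  case False
  show ?thesis
  proof (cases "m = 0")
    case True
    thus ?thesis by (simp add: rqfact_def)
  next
    case False
    with \<open>\<not> m > 0\<close> have "m < 0" by simp
    thus ?thesis by (simp add: rqfact_def)
  qed
qed

text \<open>The Gaussian binomial coefficient of \<open>2 n\<close> over \<open>n + k\<close>,
  extended by 0 to all integers \<open>k\<close>.\<close>

definition jtp_coeff :: "real \<Rightarrow> nat \<Rightarrow> int \<Rightarrow> real" where
  "jtp_coeff q n k = qfact q (2 * n) * (rqfact q (int n - k) * rqfact q (int n + k))"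

text \<open>The q-Pascal rule across two rows. All four coefficients are multiples of
  \<open>R\<close>, and since \<open>X * Y = q ^ (2 * n + 2)\<close> and \<open>c = 1 / q\<close>,
  the claim reduces to a polynomial identity in \<open>X\<close>, \<open>Y\<close>,
  \<open>c\<close>.\<close>

lemma jtp_coeff_Suc:
  assumes "t > 0"
  defines "q \<equiv> exp (- 8 * t)"
  shows "jtp_coeff q (Suc n) k = (1 + q ^ (2 * n + 1)) * jtp_coeff q n k
           + exp (- 8 * t * (of_nat n + 1 - of_int k)) * jtp_coeff q n (k - 1)
           + exp (- 8 * t * (of_nat n + 1 + of_int k)) * jtp_coeff q n (k + 1)"
proof -
  define M N where "M = int n + 1 - k" and "N = int n + 1 + k"
  define X Y c where "X = exp (- 8 * t * of_int M)" and "Y = exp (- 8 * t * of_int N)" and "c = exp (8 * t)"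
  define R where "R = rqfact q M * rqfact q N"
  have 1: "rqfact q (M - 1) = (1 - X) * rqfact q M" "rqfact q (N - 1) = (1 - Y) * rqfact q N"
    unfolding q_def X_def Y_def using assms(1) by (rule rqfact_minus_1)+
  have 2: "rqfact q (M - 2) = (1 - c * X) * rqfact q (M - 1)"
    using rqfact_minus_1[OF assms(1), of "M - 1"]
    by (simp add: q_def X_def c_def exp_add[symmetric] algebra_simps)
  have 3: "rqfact q (N - 2) = (1 - c * Y) * rqfact q (N - 1)"
    using rqfact_minus_1[OF assms(1), of "N - 1"]
    by (simp add: q_def Y_def c_def exp_add[symmetric] algebra_simps)
  have q1: "q ^ (2 * n + 2) = X * Y"
    unfolding q_def X_def Y_def exp_of_nat_mult[symmetric] exp_add[symmetric] M_def N_def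
    by (simp add: algebra_simps)
  have "c * q = 1" unfolding q_def c_def by (simp add: exp_add[symmetric])
  hence "q ^ (2 * n + 1) = c * q ^ (2 * n + 2)" by (simp add: mult.assoc[symmetric])
  hence q2: "q ^ (2 * n + 1) = c * (X * Y)" by (simp only: q1)
  have s: "qfact q (2 * Suc n) = qfact q (2 * n) * ((1 - q ^ (2 * n + 1)) * (1 - q ^ (2 * n + 2)))"
    by (simp add: qfact_def)
  have "jtp_coeff q (Suc n) k = qfact q (2 * n) * ((1 - c * (X * Y)) * (1 - X * Y)) * R"
    unfolding jtp_coeff_def s R_def M_def N_def q1 q2 by (simp add: add_ac diff_add_eq)
  moreover have "jtp_coeff q n k = qfact q (2 * n) * ((1 - X) * (1 - Y)) * R"
    using 1 by (simp add: jtp_coeff_def R_def M_def N_def)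
  moreover have "jtp_coeff q n (k - 1) = qfact q (2 * n) * ((1 - c * Y) * (1 - Y)) * R"
  proof -
    have "int n - (k - 1) = M" "int n + (k - 1) = N - 2" by (auto simp: M_def N_def)
    thus ?thesis unfolding jtp_coeff_def R_def using 1 3 by (simp only: mult_ac)
  qed
  moreover have "jtp_coeff q n (k + 1) = qfact q (2 * n) * ((1 - c * X) * (1 - X)) * R"
  proof -
    have "int n - (k + 1) = M - 2" "int n + (k + 1) = N" by (auto simp: M_def N_def)
    thus ?thesis unfolding jtp_coeff_def R_def using 1 2 by (simp only: mult_ac)
  qed
  moreover have "exp (- 8 * t * (of_nat n + 1 - of_int k)) = X" "exp (- 8 * t * (of_nat n + 1 + of_int k)) = Y"
    by (auto simp: X_def Y_def M_def N_def)
  ultimately show ?thesis unfolding q2 by (simp only:) (simp only: ring_distribs, simp add: algebra_simps)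
qed

text \<open>Cauchy's finite form of the triple product. The two factors gained from \<open>n\<close>
  to \<open>n + 1\<close>, once expanded, shift \<open>k\<close> by one in either direction as in
  \<open>jtp_coeff_Suc\<close>. Summing over all integers keeps the shifts free of boundary
  terms.\<close>

lemma jtp_finite:
  assumes "t > 0"
  defines "q \<equiv> exp (- 8 * t)"
  shows "((\<lambda>k. jtp_coeff q n k * odd_term t z k) has_sum
           exp (z - t) * (\<Prod>i<n. (1 - exp (- 2 * z) * q ^ i) * (1 - exp (2 * z) * q ^ Suc i))) UNIV"
proof (induction n)
  case 0
  show ?case
  proof (rule has_sum_finite_neutralI[where B = "{0}"])
    show "jtp_coeff q 0 k * odd_term t z k = 0" if "k \<in> UNIV - {0}" for k
      using that by (auto simp: jtp_coeff_def rqfact_def)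
  qed (auto simp: jtp_coeff_def rqfact_def qfact_def odd_term_def)
next
  case (Suc n)
  define F where "F = exp (z - t) * (\<Prod>i<n. (1 - exp (- 2 * z) * q ^ i) * (1 - exp (2 * z) * q ^ Suc i))"
  define A where "A = (\<lambda>k. jtp_coeff q n k * odd_term t z k)"
  have A: "(A has_sum F) UNIV" using Suc unfolding A_def F_def .
  have sh1: "((\<lambda>k. A (k - 1)) has_sum F) UNIV"
    by (subst has_sum_reindex_bij_betw[of "\<lambda>k. k - 1" UNIV UNIV])
       (use A in \<open>auto intro!: bij_betwI[where g = "\<lambda>k. k + 1"]\<close>)
  have sh2: "((\<lambda>k. A (k + 1)) has_sum F) UNIV"
    by (subst has_sum_reindex_bij_betw[of "\<lambda>k. k + 1" UNIV UNIV])
       (use A in \<open>auto intro!: bij_betwI[where g = "\<lambda>k. k - 1"]\<close>)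
  have "((\<lambda>k. (1 + q ^ (2 * n + 1)) * A k + (- exp (- 2 * z) * q ^ n) * A (k - 1)
           + (- exp (2 * z) * q ^ Suc n) * A (k + 1)) has_sum
          (1 + q ^ (2 * n + 1)) * F + (- exp (- 2 * z) * q ^ n) * F + (- exp (2 * z) * q ^ Suc n) * F) UNIV"
    by (intro has_sum_add has_sum_cmult_right A sh1 sh2)
  moreover have "(1 + q ^ (2 * n + 1)) * F + (- exp (- 2 * z) * q ^ n) * F + (- exp (2 * z) * q ^ Suc n) * F
    = exp (z - t) * (\<Prod>i<Suc n. (1 - exp (- 2 * z) * q ^ i) * (1 - exp (2 * z) * q ^ Suc i))"
  proof -
    define X where "X = exp (2 * z)"
    have X: "exp (- 2 * z) = 1 / X" "X \<noteq> 0" by (auto simp: X_def exp_minus field_simps)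
    have "q ^ (2 * n + 1) = q ^ n * q ^ Suc n" by (simp flip: power_add add: mult_2)
    hence "(1 + q ^ (2 * n + 1)) + (- (1 / X) * q ^ n) + (- X * q ^ Suc n)
       = (1 - (1 / X) * q ^ n) * (1 - X * q ^ Suc n)"
      using X(2) by (simp add: field_simps)
    thus ?thesis unfolding F_def X(1) X_def[symmetric] by (simp add: algebra_simps del: power_Suc)
  qed
  moreover have "(1 + q ^ (2 * n + 1)) * A k + (- exp (- 2 * z) * q ^ n) * A (k - 1)
           + (- exp (2 * z) * q ^ Suc n) * A (k + 1) = jtp_coeff q (Suc n) k * odd_term t z k" for k
  proof -
    have qn: "q ^ n = exp (- 8 * t * of_nat n)" "q ^ Suc n = exp (- 8 * t * (of_nat n + 1))"
      unfolding q_def exp_of_nat_mult[symmetric] by (simp_all add: algebra_simps)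
    have 1: "(- exp (- 2 * z) * q ^ n) * odd_term t z (k - 1)
        = odd_term t z k * exp (- 8 * t * (of_nat n + 1 - of_int k))"
      unfolding odd_term_minus_1 qn by (simp add: exp_add[symmetric] algebra_simps mult_exp_exp)
    have 2: "(- exp (2 * z) * q ^ Suc n) * odd_term t z (k + 1)
        = odd_term t z k * exp (- 8 * t * (of_nat n + 1 + of_int k))"
      unfolding odd_term_plus_1 qn by (simp add: exp_add[symmetric] algebra_simps mult_exp_exp)
    have "(1 + q ^ (2 * n + 1)) * A k + (- exp (- 2 * z) * q ^ n) * A (k - 1)
           + (- exp (2 * z) * q ^ Suc n) * A (k + 1)
      = (1 + q ^ (2 * n + 1)) * (jtp_coeff q n k * odd_term t z k)
        + jtp_coeff q n (k - 1) * ((- exp (- 2 * z) * q ^ n) * odd_term t z (k - 1))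
        + jtp_coeff q n (k + 1) * ((- exp (2 * z) * q ^ Suc n) * odd_term t z (k + 1))"
      by (simp add: A_def mult_ac)
    thus ?thesis unfolding 1 2 jtp_coeff_Suc[OF assms(1), folded q_def] by (simp add: algebra_simps)
  qed
  ultimately show ?case by (simp only:)
qed

lemma jtp_coeff_eq_0: "k \<notin> {- int n..int n} \<Longrightarrow> jtp_coeff q n k = 0"
  by (auto simp: jtp_coeff_def rqfact_def)

lemma jtp_finite_sum:
  assumes "t > 0"
  defines "q \<equiv> exp (- 8 * t)"
  shows "(\<Sum>k=- int n..int n. jtp_coeff q n k * odd_term t z k) =
           exp (z - t) * (\<Prod>i<n. (1 - exp (- 2 * z) * q ^ i) * (1 - exp (2 * z) * q ^ Suc i))"
proof (rule has_sum_unique[OF _ jtp_finite[OF assms(1), folded q_def]])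
  show "((\<lambda>k. jtp_coeff q n k * odd_term t z k) has_sum
          (\<Sum>k=- int n..int n. jtp_coeff q n k * odd_term t z k)) UNIV"
    by (rule has_sum_finite_neutralI[where B = "{- int n..int n}"]) (auto simp: jtp_coeff_eq_0)
qed

lemma jtp_coeff_bounds:
  assumes q: "0 < q" "q < 1"
  shows "0 \<le> jtp_coeff q n k" "jtp_coeff q n k \<le> 1 / (euler_prod q)\<^sup>2"
proof -
  note E = euler_prod_pos[OF q]
  have r: "0 \<le> rqfact q m" "rqfact q m \<le> 1 / euler_prod q" for m
    using qfact_pos[OF q] E euler_prod_le_qfact[OF q] by (auto simp: rqfact_def less_imp_le frac_le)
  show "0 \<le> jtp_coeff q n k"
    unfolding jtp_coeff_def using qfact_pos[OF q] r by (auto intro!: mult_nonneg_nonneg simp: less_imp_le)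
  have "jtp_coeff q n k \<le> 1 * (1 / euler_prod q * (1 / euler_prod q))"
    unfolding jtp_coeff_def
    by (intro mult_mono mult_nonneg_nonneg qfact_le_1 q r) (use E in auto)
  thus "jtp_coeff q n k \<le> 1 / (euler_prod q)\<^sup>2" by (simp add: power2_eq_square)
qed

lemma jtp_coeff_tendsto:
  assumes q: "0 < q" "q < 1"
  shows "(\<lambda>n. jtp_coeff q n k) \<longlonglongrightarrow> 1 / euler_prod q"
proof -
  note E = euler_prod_pos[OF q]
  have r: "(\<lambda>n. rqfact q (int n + m)) \<longlonglongrightarrow> 1 / euler_prod q" for m
  proof -
    have "filterlim (\<lambda>n. nat (int n + m)) at_top sequentially"
      unfolding filterlim_at_top
    proof
      fix Z
      show "\<forall>\<^sub>F n in sequentially. Z \<le> nat (int n + m)"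
        using eventually_ge_at_top[of "Z + nat \<bar>m\<bar>"] by eventually_elim linarith
    qed
    from filterlim_compose[OF qfact_tendsto[OF q] this]
    have "(\<lambda>n. 1 / qfact q (nat (int n + m))) \<longlonglongrightarrow> 1 / euler_prod q"
      using E by (intro tendsto_intros) auto
    moreover have "\<forall>\<^sub>F n in sequentially. 1 / qfact q (nat (int n + m)) = rqfact q (int n + m)"
      using eventually_ge_at_top[of "nat \<bar>m\<bar>"] by eventually_elim (auto simp: rqfact_def)
    ultimately show ?thesis by (rule Lim_transform_eventually)
  qed
  have "filterlim (\<lambda>n::nat. 2 * n) at_top sequentially"
    by (rule filterlim_subseq) (simp add: strict_mono_def)
  from filterlim_compose[OF qfact_tendsto[OF q] this]
  have "(\<lambda>n. qfact q (2 * n)) \<longlonglongrightarrow> euler_prod q" .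
  from tendsto_mult[OF this tendsto_mult[OF r[of "- k"] r[of k]]]
  show ?thesis using E by (simp add: jtp_coeff_def)
qed

text \<open>Tannery's theorem with the bound of \<open>jtp_coeff_bounds\<close>, which is uniform in
  \<open>n\<close> and \<open>k\<close>. A general \<open>v\<close> lets it serve both the triple
  product and its derivative at \<open>z = 0\<close>.\<close>

lemma jtp_limit:
  assumes q: "0 < q" "q < 1" and v: "(v has_sum S) UNIV"
  shows "(\<lambda>n. \<Sum>k=- int n..int n. jtp_coeff q n k * v k) \<longlonglongrightarrow> S / euler_prod q"
proof -
  have abs: "((\<lambda>k. norm (v k)) has_sum (\<Sum>\<^sub>\<infinity>k. norm (v k))) UNIV"
    by (rule has_sum_infsum,
        rule summable_on_iff_abs_summable_on_real[THEN iffD1, OF has_sum_imp_summable[OF v]])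
  define a where "a = (\<lambda>i n. jtp_coeff q n (int_decode i) * v (int_decode i))"
  have "(\<lambda>n. \<Sum>i. a i n) \<longlonglongrightarrow> (\<Sum>i. 1 / euler_prod q * v (int_decode i))"
  proof (rule tannerys_theorem[THEN conjunct2, THEN conjunct2])
    show "(\<lambda>n. a i n) \<longlonglongrightarrow> 1 / euler_prod q * v (int_decode i)" for i
      unfolding a_def by (intro tendsto_mult jtp_coeff_tendsto q tendsto_const)
    show "\<forall>\<^sub>F (i, n) in at_top \<times>\<^sub>F sequentially.
        norm (a i n) \<le> 1 / (euler_prod q)\<^sup>2 * norm (v (int_decode i))"
    proof (rule always_eventually, safe)
      fix i n
      show "norm (a i n) \<le> 1 / (euler_prod q)\<^sup>2 * norm (v (int_decode i))"
        using jtp_coeff_bounds[OF q, of n "int_decode i"] unfolding a_def norm_mult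
        by (intro mult_right_mono) auto
    qed
    show "summable (\<lambda>i. 1 / (euler_prod q)\<^sup>2 * norm (v (int_decode i)))"
      by (intro summable_mult) (use sums_int_decode[OF abs] in \<open>simp add: sums_iff\<close>)
  qed simp
  moreover have "(\<Sum>i. a i n) = (\<Sum>k=- int n..int n. jtp_coeff q n k * v k)" for n
  proof -
    have "((\<lambda>k. jtp_coeff q n k * v k) has_sum (\<Sum>k=- int n..int n. jtp_coeff q n k * v k)) UNIV"
      by (rule has_sum_finite_neutralI[where B = "{- int n..int n}"]) (auto simp: jtp_coeff_eq_0)
    from sums_int_decode[OF this] show ?thesis unfolding a_def by (simp add: sums_iff)
  qed
  moreover have "(\<Sum>i. 1 / euler_prod q * v (int_decode i)) = S / euler_prod q"
    using sums_mult[OF sums_int_decode[OF v], of "1 / euler_prod q"] by (simp add: sums_iff)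
  ultimately show ?thesis by (simp only:)
qed

theorem jacobi_triple_product:
  assumes t: "t > 0"
  defines "q \<equiv> exp (- 8 * t)"
  shows "(\<lambda>n. exp (z - t) * (\<Prod>i<n. (1 - exp (- 2 * z) * q ^ i) * (1 - exp (2 * z) * q ^ Suc i)))
           \<longlonglongrightarrow> theta t 0 z / euler_prod q"
proof -
  have q: "0 < q" "q < 1" using t by (auto simp: q_def)
  have "(odd_term t z has_sum theta t 0 z) UNIV" using has_sum_odd_term[OF t, of z 0] by simp
  from jtp_limit[OF q this] show ?thesis
    unfolding q_def jtp_finite_sum[OF t] .
qed

text \<open>The finite identity is differentiated at \<open>z = 0\<close> before the limit is taken,
  so limit and derivative are never interchanged.\<close>

theorem jacobi_euler_cube:
  assumes t: "t > 0"
  defines "q \<equiv> exp (- 8 * t)"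
  shows "theta t 1 0 = 2 * exp (- t) * euler_prod q ^ 3"
proof -
  have q: "0 < q" "q < 1" using t by (auto simp: q_def)
  have "((\<lambda>k. odd_term t 0 k * (1 - 2 * of_int k)) has_sum theta t 1 0) UNIV"
    using has_sum_odd_term[OF t, of 0 1] by simp
  from jtp_limit[OF q this]
  have lim: "(\<lambda>n. \<Sum>k=- int n..int n. jtp_coeff q n k * (odd_term t 0 k * (1 - 2 * of_int k)))
     \<longlonglongrightarrow> theta t 1 0 / euler_prod q" .
  have eq: "(\<Sum>k=- int (Suc n)..int (Suc n). jtp_coeff q (Suc n) k * (odd_term t 0 k * (1 - 2 * of_int k)))
      = 2 * exp (- t) * (qfact q n * qfact q (Suc n))" for n
  proof -
    \<comment> \<open>The product without its factor \<open>1 - exp (- 2 * z)\<close>, the only one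
      that vanishes at \<open>z = 0\<close>; hence one range has \<open>n\<close> factors and the
      other \<open>Suc n\<close>.\<close>
    define P where "P = (\<lambda>z. (\<Prod>i<n. 1 - exp (- 2 * z) * q ^ Suc i) * (\<Prod>i<Suc n. 1 - exp (2 * z) * q ^ Suc i))"
    have cont: "isCont P 0" unfolding P_def by (intro continuous_intros)
    have prod: "(\<Sum>k=- int (Suc n)..int (Suc n). jtp_coeff q (Suc n) k * odd_term t z k)
        = exp (z - t) * (1 - exp (- 2 * z)) * P z" for z
      unfolding jtp_finite_sum[OF t, folded q_def] P_def prod.distrib
      by (simp add: prod.lessThan_Suc_shift del: power_Suc prod.lessThan_Suc)
    have "((\<lambda>z. \<Sum>k=- int (Suc n)..int (Suc n). jtp_coeff q (Suc n) k * odd_term t z k) has_real_derivative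
        (\<Sum>k=- int (Suc n)..int (Suc n). jtp_coeff q (Suc n) k * (odd_term t 0 k * (1 - 2 * of_int k)))) (at 0)"
    proof (intro DERIV_sum DERIV_cmult)
      show "((\<lambda>z. odd_term t z k) has_real_derivative odd_term t 0 k * (1 - 2 * of_int k)) (at 0)" for k
        unfolding odd_term_def by (auto intro!: derivative_eq_intros)
    qed
    moreover have "((\<lambda>z. exp (z - t) * (1 - exp (- 2 * z)) * P z) has_real_derivative
        2 * exp (- t) * P 0) (at 0)"
    proof -
      \<comment> \<open>As \<open>g 0 = 0\<close>, the difference quotient of \<open>g * P\<close>
        at 0 is that of \<open>g\<close> times \<open>P z\<close>, and continuity of
        \<open>P\<close> suffices.\<close>
      define g where "g = (\<lambda>z. exp (z - t) * (1 - exp (- 2 * z)))"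
      have "(g has_real_derivative 2 * exp (- t)) (at 0)"
        unfolding g_def by (auto intro!: derivative_eq_intros)
      hence "(\<lambda>z. (g z - g 0) / (z - 0)) \<midarrow>0\<rightarrow> 2 * exp (- t)"
        by (simp add: has_field_derivative_iff)
      hence "(\<lambda>z. (g z - g 0) / (z - 0) * P z) \<midarrow>0\<rightarrow> 2 * exp (- t) * P 0"
        using cont by (intro tendsto_mult) (auto simp: isCont_def)
      hence "(\<lambda>z. (g z * P z - g 0 * P 0) / (z - 0)) \<midarrow>0\<rightarrow> 2 * exp (- t) * P 0"
        by (simp add: g_def)
      thus ?thesis unfolding g_def by (simp add: has_field_derivative_iff)
    qed
    ultimately have "(\<Sum>k=- int (Suc n)..int (Suc n). jtp_coeff q (Suc n) k * (odd_term t 0 k * (1 - 2 * of_int k)))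
        = 2 * exp (- t) * P 0"
      unfolding prod by (rule DERIV_unique)
    thus ?thesis by (simp add: P_def qfact_def)
  qed
  have "(\<lambda>n. 2 * exp (- t) * (qfact q n * qfact q (Suc n))) \<longlonglongrightarrow> theta t 1 0 / euler_prod q"
    using LIMSEQ_Suc[OF lim] unfolding eq .
  moreover have "(\<lambda>n. 2 * exp (- t) * (qfact q n * qfact q (Suc n))) \<longlonglongrightarrow>
      2 * exp (- t) * (euler_prod q * euler_prod q)"
    by (intro tendsto_mult tendsto_const qfact_tendsto[OF q] LIMSEQ_Suc)
  ultimately have "theta t 1 0 / euler_prod q = 2 * exp (- t) * (euler_prod q * euler_prod q)"
    by (rule LIMSEQ_unique)
  thus ?thesis using euler_prod_pos[OF q] by (simp add: field_simps power3_eq_cube)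
qed

section \<open>Addition formulas for the theta function\<close>

lemma theta_deriv:
  assumes "t > 0"
  shows "(theta t j has_real_derivative theta t (Suc j) z) (at z)"
  using has_real_derivative_gsum[OF exp_bounded_chi4[of j], of t 0 z 0 1] assms
  unfolding theta_def by (simp add: mult_ac eta_contract_eq)

text \<open>The heat equation: each term satisfies \<open>d/dt = - d^2/dz^2\<close>, so moving the
  modulus costs two derivatives in the argument.\<close>

lemma theta_deriv_line:
  assumes "a * s > 0"
  shows "((\<lambda>s. theta (a * s) j (b * s)) has_real_derivative
           b * theta (a * s) (Suc j) (b * s) - a * theta (a * s) (Suc (Suc j)) (b * s)) (at s)"
proof -
  have "((\<lambda>n. b * (chi4 n * of_int n ^ Suc j * exp (b * s * of_int n - a * s * (of_int n)\<^sup>2))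
          + - a * (chi4 n * of_int n ^ Suc (Suc j) * exp (b * s * of_int n - a * s * (of_int n)\<^sup>2)))
       has_sum b * theta (a * s) (Suc j) (b * s) + - a * theta (a * s) (Suc (Suc j)) (b * s)) UNIV"
    unfolding theta_def by (intro has_sum_add has_sum_cmult_right has_sum_gsum exp_bounded_chi4 assms)
  hence "gsum (\<lambda>n. chi4 n * of_int n ^ j * (b * of_int n - a * (of_int n)\<^sup>2)) (a * s) (b * s)
      = b * theta (a * s) (Suc j) (b * s) - a * theta (a * s) (Suc (Suc j)) (b * s)"
    unfolding gsum_def by (intro infsumI) (simp add: algebra_simps power2_eq_square)
  thus ?thesis
    using has_real_derivative_gsum[OF exp_bounded_chi4[of j], of 0 a s 0 b] assms
    unfolding theta_def by simp
qed

lemma gsum_minus: "gsum c t (- z) = gsum (\<lambda>n. c (- n)) t z"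
proof -
  have "gsum c t (- z) = (\<Sum>\<^sub>\<infinity>n. c (- n) * exp ((- z) * of_int (- n) - t * (of_int (- n))\<^sup>2))"
    unfolding gsum_def by (rule infsum_reindex_bij_betw[symmetric]) (auto intro: bij_betwI[where g = uminus])
  thus ?thesis by (simp add: gsum_def)
qed

lemma gsum_uminus: "gsum (\<lambda>n. - c n) t z = - gsum c t z"
  unfolding gsum_def by (simp add: infsum_uminus)

lemma theta_minus: "theta t j (- z) = (if even j then - theta t j z else theta t j z)"
  unfolding theta_def gsum_minus by (auto simp: chi4_minus gsum_uminus[symmetric])

lemma theta_0: "even j \<Longrightarrow> theta t j 0 = 0"
  using theta_minus[of t j 0] by simp

text \<open>Reindexing by 2, the least shift that preserves odd integers, and completing the
  square.\<close>

lemma theta_shift: "theta t 0 (z + 4 * t) = - exp (4 * t + 2 * z) * theta t 0 z"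
proof -
  have "theta t 0 (z + 4 * t) =
      (\<Sum>\<^sub>\<infinity>n. chi4 (n + 2) * exp ((z + 4 * t) * of_int (n + 2) - t * (of_int (n + 2))\<^sup>2))"
    unfolding theta_def gsum_def
    by (subst infsum_reindex_bij_betw[of "\<lambda>n. n + 2" UNIV UNIV, symmetric])
       (auto intro: bij_betwI[where g = "\<lambda>n. n - 2"])
  also have "\<dots> = (\<Sum>\<^sub>\<infinity>n. - exp (4 * t + 2 * z) * (chi4 n * exp (z * of_int n - t * (of_int n)\<^sup>2)))"
    by (intro infsum_cong)
       (simp add: chi4_add_2 exp_add[symmetric] mult_exp_exp power2_eq_square algebra_simps)
  also have "\<dots> = - exp (4 * t + 2 * z) * theta t 0 z"
    unfolding theta_def gsum_def by (simp only: infsum_cmult_right') simp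
  finally show ?thesis .
qed

text \<open>For \<open>j = 0\<close> these are Jacobi's theta_3 (even \<open>n\<close>) and theta_2
  (odd \<open>n\<close>) with the nome squared. The doubled modulus and argument come from
  \<open>(s + d)^2 + (s - d)^2 = 2 s^2 + 2 d^2\<close>; the factor \<open>(2 n)^j\<close> makes
  \<open>j\<close> count derivatives in \<open>x\<close>.\<close>

definition parity_theta :: "bool \<Rightarrow> real \<Rightarrow> nat \<Rightarrow> real \<Rightarrow> real" where
  "parity_theta p t j x = gsum (\<lambda>n. of_bool (even n = p) * (2 * of_int n) ^ j) (2 * t) (2 * x)"

lemma exp_bounded_parity: "exp_bounded (\<lambda>n. of_bool (even n = p) * (2 * of_int n) ^ j)"
  by (intro exp_bounded_mult exp_bounded_power exp_bounded_of_int exp_bounded_const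
        exp_bounded_of_bounded[of "\<lambda>n. of_bool (even n = p)" 1]) auto

lemma parity_theta_deriv:
  assumes "t > 0"
  shows "(parity_theta p t j has_real_derivative parity_theta p t (Suc j) x) (at x)"
  using has_real_derivative_gsum[OF exp_bounded_parity[of p j], of "2 * t" 0 x 0 2] assms
  unfolding parity_theta_def by (simp add: mult_ac eta_contract_eq)

lemma parity_theta_0: 
  assumes "odd j" 
  shows "parity_theta p t j 0 = 0"
  using assms gsum_minus[of "\<lambda>n. of_bool (even n = p) * (2 * of_int n) ^ j" "2 * t" 0]
  by (simp add: parity_theta_def gsum_uminus)

lemma has_sum_product:
  fixes f g :: "_ \<Rightarrow> real"
  assumes "(f has_sum S) A" "(g has_sum T) B"
  shows "((\<lambda>(x, y). f x * g y) has_sum S * T) (A \<times> B)"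
proof (rule has_sum_SigmaI)
  show "((\<lambda>y. case (x, y) of (x, y) \<Rightarrow> f x * g y) has_sum f x * T) B" for x
    using has_sum_cmult_right[OF assms(2)] by simp
  show "((\<lambda>x. f x * T) has_sum S * T) A"
    by (rule has_sum_cmult_left[OF assms(1)])
  have f: "(\<lambda>x. norm (f x)) summable_on A" and g: "(\<lambda>x. norm (g x)) summable_on B"
    using assms[THEN has_sum_imp_summable] summable_on_iff_abs_summable_on_real by blast+
  have "(\<lambda>p. norm (case p of (x, y) \<Rightarrow> f x * g y)) summable_on A \<times> B"
    unfolding Infinite_Sum.abs_summable_on_Sigma_iff
  proof (intro conjI ballI)
    show "(\<lambda>y. norm (case (x, y) of (x, y) \<Rightarrow> f x * g y)) summable_on B" for x
      using summable_on_cmult_right[OF g, of "norm (f x)"] by (simp add: abs_mult)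
    have "(\<lambda>x. norm (f x) * (\<Sum>\<^sub>\<infinity>y\<in>B. norm (g y))) summable_on A"
      by (rule summable_on_cmult_left[OF f])
    moreover have "norm (\<Sum>\<^sub>\<infinity>y\<in>B. norm (case (x, y) of (x, y) \<Rightarrow> f x * g y)) = norm (f x) * (\<Sum>\<^sub>\<infinity>y\<in>B. norm (g y))" for x
      by (simp add: abs_mult infsum_cmult_right' infsum_nonneg)
    ultimately show "(\<lambda>x. norm (\<Sum>\<^sub>\<infinity>y\<in>B. norm (case (x, y) of (x, y) \<Rightarrow> f x * g y))) summable_on A"
      by simp
  qed
  thus "(\<lambda>(x, y). f x * g y) summable_on A \<times> B"
    by (rule abs_summable_summable)
qed

lemma chi4_mult_chi4:
  assumes "odd (s + d)"
  shows "chi4 (s + d) * chi4 (s - d) = (if odd s then 1 else -1)"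
proof (cases "odd s")
  case True
  then obtain i where i: "s = 2 * i + 1" by (elim oddE)
  with assms have "even d" by simp
  then obtain j where j: "d = 2 * j" by (elim evenE)
  have "s + d = 2 * (i + j) + 1" "s - d = 2 * (i - j) + 1" by (auto simp: i j)
  thus ?thesis using True by (simp only: chi4_odd) auto
next
  case False
  hence "even s" by simp
  then obtain i where i: "s = 2 * i" by (elim evenE)
  with assms have "odd d" by simp
  then obtain j where j: "d = 2 * j + 1" by (elim oddE)
  have "s + d = 2 * (i + j) + 1" "s - d = 2 * (i - j - 1) + 1" by (auto simp: i j)
  thus ?thesis using False by (simp only: chi4_odd) auto
qed

text \<open>Put \<open>m = s + d\<close>, \<open>n = s - d\<close> in the double series. Pairs of
  odd \<open>m\<close>, \<open>n\<close> correspond to pairs \<open>s\<close>, \<open>d\<close> of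
  opposite parity; which of the two is odd decides the sign and the product to which the term
  belongs.\<close>

lemma theta_addition:
  assumes t: "t > 0"
  shows "theta t 0 (x + y) * theta t 0 (x - y) =
           parity_theta False t 0 x * parity_theta True t 0 y
           - parity_theta True t 0 x * parity_theta False t 0 y"
proof -
  define F where "F = (\<lambda>z n. chi4 n * exp (z * of_int n - t * (of_int n)\<^sup>2))"
  define G where "G = (\<lambda>p x n. of_bool (even n = p) * exp (2 * x * of_int n - 2 * t * (of_int n)\<^sup>2))"
  have F: "(F z has_sum theta t 0 z) UNIV" for z
    using has_sum_gsum[OF exp_bounded_chi4[of 0] t, of z] by (simp add: F_def theta_def)
  have G: "(G p x has_sum parity_theta p t 0 x) UNIV" for p x
    using has_sum_gsum[OF exp_bounded_parity[of p 0], of "2 * t" "2 * x"] t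
    by (simp add: G_def parity_theta_def mult_ac)
  define L where "L = (\<lambda>(m, n). F (x + y) m * F (x - y) n)"
  define R where "R = (\<lambda>(s, d). G False x s * G True y d - G True x s * G False y d)"
  have L: "(L has_sum theta t 0 (x + y) * theta t 0 (x - y)) (UNIV \<times> UNIV)"
    unfolding L_def by (rule has_sum_product[OF F F])
  have R: "(R has_sum (parity_theta False t 0 x * parity_theta True t 0 y
           - parity_theta True t 0 x * parity_theta False t 0 y)) (UNIV \<times> UNIV)"
  proof -
    have "((\<lambda>p. (case p of (s, d) \<Rightarrow> G False x s * G True y d) + - (case p of (s, d) \<Rightarrow> G True x s * G False y d))
       has_sum (parity_theta False t 0 x * parity_theta True t 0 y
           + - (parity_theta True t 0 x * parity_theta False t 0 y))) (UNIV \<times> UNIV)"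
      by (intro has_sum_add has_sum_uminusI has_sum_product G)
    thus ?thesis by (simp add: R_def case_prod_unfold)
  qed
  define A where "A = {(m::int, n::int). odd m \<and> odd n}"
  define B where "B = {(s::int, d::int). odd (s + d)}"
  have LA: "(L has_sum theta t 0 (x + y) * theta t 0 (x - y)) A"
    using L
  proof (subst has_sum_cong_neutral[where g = L and T = "UNIV \<times> UNIV"])
    show "L p = 0" if "p \<in> UNIV \<times> UNIV - A" for p
      using that by (cases p) (auto simp: L_def A_def F_def chi4_even)
  qed auto
  have RB: "(R has_sum (parity_theta False t 0 x * parity_theta True t 0 y
           - parity_theta True t 0 x * parity_theta False t 0 y)) B"
    using R
  proof (subst has_sum_cong_neutral[where g = R and T = "UNIV \<times> UNIV"])
    show "R p = 0" if "p \<in> UNIV \<times> UNIV - B" for p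
      using that by (cases p) (auto simp: R_def B_def G_def)
  qed auto
  have "(R has_sum theta t 0 (x + y) * theta t 0 (x - y)) B \<longleftrightarrow>
        (L has_sum theta t 0 (x + y) * theta t 0 (x - y)) A"
  proof (rule has_sum_reindex_bij_witness[where i = "\<lambda>(m, n). ((m + n) div 2, (m - n) div 2)"
          and j = "\<lambda>(s, d). (s + d, s - d)"])
    fix a assume a: "a \<in> B"
    obtain s d where sd: "a = (s, d)" by (cases a)
    have odd: "odd (s + d)" using a by (simp add: B_def sd)
    show "(\<lambda>(m, n). ((m + n) div 2, (m - n) div 2)) ((\<lambda>(s, d). (s + d, s - d)) a) = a"
      by (simp add: sd)
    show "(\<lambda>(s, d). (s + d, s - d)) a \<in> A" using odd by (auto simp: A_def sd)
    have "L (s + d, s - d) = (chi4 (s + d) * chi4 (s - d)) *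
        (exp (2 * x * of_int s - 2 * t * (of_int s)\<^sup>2) * exp (2 * y * of_int d - 2 * t * (of_int d)\<^sup>2))"
      unfolding L_def F_def by (simp add: exp_add[symmetric] mult_exp_exp power2_eq_square algebra_simps)
    thus "L ((\<lambda>(s, d). (s + d, s - d)) a) = R a"
      using odd unfolding sd R_def G_def chi4_mult_chi4[OF odd] by auto
  next
    fix b assume b: "b \<in> A"
    obtain m n where mn: "b = (m, n)" by (cases b)
    have odd: "odd m" "odd n" using b by (auto simp: A_def mn)
    then obtain i j where ij: "m = 2 * i + 1" "n = 2 * j + 1" by (elim oddE)
    have *: "(m + n) div 2 = i + j + 1" "(m - n) div 2 = i - j" by (auto simp: ij)
    show "(\<lambda>(s, d). (s + d, s - d)) ((\<lambda>(m, n). ((m + n) div 2, (m - n) div 2)) b) = b"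
      by (simp add: mn *) (simp add: ij)
    show "(\<lambda>(m, n). ((m + n) div 2, (m - n) div 2)) b \<in> B"
      by (simp add: mn * B_def)
  qed auto
  with LA RB show ?thesis using has_sum_unique by blast
qed


section \<open>Bilinear identities obtained by differentiating the addition formula\<close>

context
  fixes t :: real
  assumes t: "t > 0"
begin

private abbreviation "T \<equiv> theta t"
private abbreviation "E \<equiv> parity_theta True t"
private abbreviation "O' \<equiv> parity_theta False t"

lemmas theta_derivs =
  theta_deriv[OF t, THEN DERIV_chain2] parity_theta_deriv[OF t, THEN DERIV_chain2]

text \<open>With \<open>w = (O', E)\<close>, each derivative in \<open>y\<close> leaves a
  determinant of \<open>w(x)\<close> and a derivative of \<open>w(y)\<close> on the right, while the
  left becomes a Hirota derivative of theta. At \<open>y = 0\<close> these express polynomials in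
  theta and its derivatives as determinants.\<close>

lemma theta_addition_dy1:
  "T 1 (x + y) * T 0 (x - y) - T 0 (x + y) * T 1 (x - y) = O' 0 x * E 1 y - E 0 x * O' 1 y"
proof -
  have "((\<lambda>y. T 0 (x + y) * T 0 (x - y)) has_real_derivative
      T 1 (x + y) * T 0 (x - y) - T 0 (x + y) * T 1 (x - y)) (at y)"
    by (rule derivative_eq_intros theta_derivs refl | simp)+
  moreover have "((\<lambda>y. O' 0 x * E 0 y - E 0 x * O' 0 y) has_real_derivative
      O' 0 x * E 1 y - E 0 x * O' 1 y) (at y)"
    by (rule derivative_eq_intros theta_derivs refl | simp)+
  ultimately show ?thesis unfolding theta_addition[OF t] by (rule DERIV_unique)
qed

lemma theta_addition_dy2:
  "T 2 (x + y) * T 0 (x - y) - 2 * T 1 (x + y) * T 1 (x - y) + T 0 (x + y) * T 2 (x - y) =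
     O' 0 x * E 2 y - E 0 x * O' 2 y"
proof -
  have "((\<lambda>y. T 1 (x + y) * T 0 (x - y) - T 0 (x + y) * T 1 (x - y)) has_real_derivative
      T 2 (x + y) * T 0 (x - y) - 2 * T 1 (x + y) * T 1 (x - y) + T 0 (x + y) * T 2 (x - y)) (at y)"
    by (rule derivative_eq_intros theta_derivs refl | simp add: numeral_2_eq_2)+
  moreover have "((\<lambda>y. O' 0 x * E 1 y - E 0 x * O' 1 y) has_real_derivative
      O' 0 x * E 2 y - E 0 x * O' 2 y) (at y)"
    by (rule derivative_eq_intros theta_derivs refl | simp add: numeral_2_eq_2)+
  ultimately show ?thesis unfolding theta_addition_dy1 by (rule DERIV_unique)
qed

lemma theta_addition_dy3:
  "T 3 (x + y) * T 0 (x - y) - 3 * T 2 (x + y) * T 1 (x - y) + 3 * T 1 (x + y) * T 2 (x - y)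
     - T 0 (x + y) * T 3 (x - y) = O' 0 x * E 3 y - E 0 x * O' 3 y"
proof -
  have "((\<lambda>y. T 2 (x + y) * T 0 (x - y) - 2 * T 1 (x + y) * T 1 (x - y) + T 0 (x + y) * T 2 (x - y)) has_real_derivative
      T 3 (x + y) * T 0 (x - y) - 3 * T 2 (x + y) * T 1 (x - y) + 3 * T 1 (x + y) * T 2 (x - y)
     - T 0 (x + y) * T 3 (x - y)) (at y)"
    by (rule derivative_eq_intros theta_derivs refl | simp add: numeral_2_eq_2 numeral_3_eq_3)+
  moreover have "((\<lambda>y. O' 0 x * E 2 y - E 0 x * O' 2 y) has_real_derivative
      O' 0 x * E 3 y - E 0 x * O' 3 y) (at y)"
    by (rule derivative_eq_intros theta_derivs refl | simp add: numeral_2_eq_2 numeral_3_eq_3)+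
  ultimately show ?thesis unfolding theta_addition_dy2 by (rule DERIV_unique)
qed

lemma theta_addition_dy4:
  "T 4 (x + y) * T 0 (x - y) - 4 * T 3 (x + y) * T 1 (x - y) + 6 * T 2 (x + y) * T 2 (x - y)
     - 4 * T 1 (x + y) * T 3 (x - y) + T 0 (x + y) * T 4 (x - y) = O' 0 x * E 4 y - E 0 x * O' 4 y"
proof -
  have "((\<lambda>y. T 3 (x + y) * T 0 (x - y) - 3 * T 2 (x + y) * T 1 (x - y) + 3 * T 1 (x + y) * T 2 (x - y)
     - T 0 (x + y) * T 3 (x - y)) has_real_derivative
      T 4 (x + y) * T 0 (x - y) - 4 * T 3 (x + y) * T 1 (x - y) + 6 * T 2 (x + y) * T 2 (x - y)
     - 4 * T 1 (x + y) * T 3 (x - y) + T 0 (x + y) * T 4 (x - y)) (at y)"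
    by (rule derivative_eq_intros theta_derivs refl | simp add: eval_nat_numeral)+
  moreover have "((\<lambda>y. O' 0 x * E 3 y - E 0 x * O' 3 y) has_real_derivative
      O' 0 x * E 4 y - E 0 x * O' 4 y) (at y)"
    by (rule derivative_eq_intros theta_derivs refl | simp add: eval_nat_numeral)+
  ultimately show ?thesis unfolding theta_addition_dy3 by (rule DERIV_unique)
qed

lemma theta_square: "(T 0 x)\<^sup>2 = O' 0 x * E 0 0 - E 0 x * O' 0 0"
  using theta_addition[OF t, of x 0] by (simp add: power2_eq_square)

lemma theta_square_deriv: "2 * T 0 x * T 1 x = O' 1 x * E 0 0 - E 1 x * O' 0 0"
proof -
  have "((\<lambda>x. (T 0 x)\<^sup>2) has_real_derivative 2 * T 0 x * T 1 x) (at x)"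
    by (rule derivative_eq_intros theta_derivs refl | simp)+
  moreover have "((\<lambda>x. O' 0 x * E 0 0 - E 0 x * O' 0 0) has_real_derivative
      O' 1 x * E 0 0 - E 1 x * O' 0 0) (at x)"
    by (rule derivative_eq_intros theta_derivs refl | simp)+
  ultimately show ?thesis unfolding theta_square by (rule DERIV_unique)
qed

lemma theta_addition_dx:
  "T 1 (x + y) * T 0 (x - y) + T 0 (x + y) * T 1 (x - y) = O' 1 x * E 0 y - E 1 x * O' 0 y"
proof -
  have "((\<lambda>x. T 0 (x + y) * T 0 (x - y)) has_real_derivative
      T 1 (x + y) * T 0 (x - y) + T 0 (x + y) * T 1 (x - y)) (at x)"
    by (rule derivative_eq_intros theta_derivs refl | simp)+
  moreover have "((\<lambda>x. O' 0 x * E 0 y - E 0 x * O' 0 y) has_real_derivative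
      O' 1 x * E 0 y - E 1 x * O' 0 y) (at x)"
    by (rule derivative_eq_intros theta_derivs refl | simp)+
  ultimately show ?thesis unfolding theta_addition[OF t] by (rule DERIV_unique)
qed

text \<open>At \<open>y = x\<close> one of the two terms contains \<open>T 0 0 = 0\<close>.
  Differentiating further and setting \<open>x = 0\<close> gives the determinants of
  \<open>wronskian_2\<close> and \<open>wronskian_4\<close>.\<close>

lemma theta_double: "T 1 0 * T 0 (2 * x) = O' 1 x * E 0 x - E 1 x * O' 0 x"
  using theta_addition_dx[of x x] by (simp add: theta_0 mult_ac)

lemma theta_double_d1: "2 * T 1 0 * T 1 (2 * x) = O' 2 x * E 0 x - E 2 x * O' 0 x"
proof -
  have "((\<lambda>x. T 1 0 * T 0 (2 * x)) has_real_derivative 2 * T 1 0 * T 1 (2 * x)) (at x)"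
    by (rule derivative_eq_intros theta_derivs refl | simp)+
  moreover have "((\<lambda>x. O' 1 x * E 0 x - E 1 x * O' 0 x) has_real_derivative
      O' 2 x * E 0 x - E 2 x * O' 0 x) (at x)"
    by (rule derivative_eq_intros theta_derivs refl | simp add: numeral_2_eq_2)+
  ultimately show ?thesis unfolding theta_double by (rule DERIV_unique)
qed

lemma theta_double_d2: "4 * T 1 0 * T 2 (2 * x) = O' 3 x * E 0 x + O' 2 x * E 1 x - E 3 x * O' 0 x - E 2 x * O' 1 x"
proof -
  have "((\<lambda>x. 2 * T 1 0 * T 1 (2 * x)) has_real_derivative 4 * T 1 0 * T 2 (2 * x)) (at x)"
    by (rule derivative_eq_intros theta_derivs refl | simp add: numeral_2_eq_2)+
  moreover have "((\<lambda>x. O' 2 x * E 0 x - E 2 x * O' 0 x) has_real_derivative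
      O' 3 x * E 0 x + O' 2 x * E 1 x - E 3 x * O' 0 x - E 2 x * O' 1 x) (at x)"
    by (rule derivative_eq_intros theta_derivs refl | simp add: numeral_2_eq_2 numeral_3_eq_3)+
  ultimately show ?thesis unfolding theta_double_d1 by (rule DERIV_unique)
qed

lemma theta_double_d3:
  "8 * T 1 0 * T 3 (2 * x) = O' 4 x * E 0 x + 2 * O' 3 x * E 1 x - E 4 x * O' 0 x - 2 * E 3 x * O' 1 x"
proof -
  have "((\<lambda>x. 4 * T 1 0 * T 2 (2 * x)) has_real_derivative 8 * T 1 0 * T 3 (2 * x)) (at x)"
    by (rule derivative_eq_intros theta_derivs refl | simp add: eval_nat_numeral)+
  moreover have "((\<lambda>x. O' 3 x * E 0 x + O' 2 x * E 1 x - E 3 x * O' 0 x - E 2 x * O' 1 x) has_real_derivative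
      O' 4 x * E 0 x + 2 * O' 3 x * E 1 x - E 4 x * O' 0 x - 2 * E 3 x * O' 1 x) (at x)"
    by (rule derivative_eq_intros theta_derivs refl | simp add: eval_nat_numeral)+
  ultimately show ?thesis unfolding theta_double_d2 by (rule DERIV_unique)
qed

lemma wronskian_2: "2 * (T 1 0)\<^sup>2 = O' 2 0 * E 0 0 - E 2 0 * O' 0 0"
  using theta_double_d1[of 0] by (simp add: power2_eq_square)

lemma wronskian_4: "8 * T 1 0 * T 3 0 = O' 4 0 * E 0 0 - E 4 0 * O' 0 0"
  using theta_double_d3[of 0] by (simp add: parity_theta_0)

text \<open>The Pluecker relation for the four plane vectors \<open>w(x)\<close>,
  \<open>w'(x)\<close>, \<open>w(y)\<close>, \<open>w(0)\<close>.\<close>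

lemma theta_weight_one:
  "(T 1 (x + y) * T 0 (x - y) + T 0 (x + y) * T 1 (x - y)) * (T 0 x)\<^sup>2
     - 2 * T 0 x * T 1 x * (T 0 (x + y) * T 0 (x - y)) = T 1 0 * T 0 (2 * x) * (T 0 y)\<^sup>2"
  unfolding theta_addition[OF t] theta_addition_dx theta_square theta_square_deriv theta_double
  by algebra

definition theta_N :: "real \<Rightarrow> real" where
  "theta_N x = (T 1 x)\<^sup>2 - T 2 x * T 0 x"

lemma theta_N_eq: "- 2 * theta_N x = O' 0 x * E 2 0 - E 0 x * O' 2 0"
  using theta_addition_dy2[of x 0] by (simp add: theta_N_def power2_eq_square algebra_simps)

text \<open>The Pluecker relation for \<open>w(x)\<close>, \<open>w(y)\<close>, \<open>w(0)\<close>,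
  \<open>w''(0)\<close>. It is the sigma function formula for \<open>wp(x) - wp(y)\<close> with
  denominators cleared.\<close>

lemma theta_N_diff:
  "theta_N x * (T 0 y)\<^sup>2 - theta_N y * (T 0 x)\<^sup>2 = - (T 1 0)\<^sup>2 * (T 0 (x + y) * T 0 (x - y))"
proof -
  have "(- 2 * theta_N x) * (T 0 y)\<^sup>2 - (- 2 * theta_N y) * (T 0 x)\<^sup>2 = (2 * (T 1 0)\<^sup>2) * (T 0 (x + y) * T 0 (x - y))"
    unfolding theta_addition[OF t] theta_square theta_N_eq wronskian_2 by algebra
  thus ?thesis by simp
qed

text \<open>The left-hand side is the determinant of \<open>w(x)\<close> and
  \<open>w''''(0)\<close>. By \<open>wronskian_2\<close> the vectors \<open>w(0)\<close> and
  \<open>w''(0)\<close> form a basis, and expanding \<open>w''''(0)\<close> in it gives the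
  right-hand side. Only the constancy of \<open>l\<close> in \<open>x\<close> matters later, since
  \<open>l\<close> disappears on differentiation.\<close>

lemma theta_quartic:
  assumes "T 1 0 \<noteq> 0"
  obtains l where "\<And>x. 2 * T 4 x * T 0 x - 8 * T 3 x * T 1 x + 6 * (T 2 x)\<^sup>2
      = l * (T 0 x)\<^sup>2 - 2 * (4 * T 3 0 / T 1 0) * theta_N x"
proof
  define m where "m = 4 * T 3 0 / T 1 0"
  define D where "D = O' 2 0 * E 0 0 - E 2 0 * O' 0 0"
  have D: "D = 2 * (T 1 0)\<^sup>2" using wronskian_2 by (simp add: D_def)
  have m: "m * D = O' 4 0 * E 0 0 - E 4 0 * O' 0 0"
    using assms unfolding D m_def wronskian_4[symmetric] by (simp add: power2_eq_square)
  have D0: "D \<noteq> 0" using assms D by simp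
  define l where "l = (E 4 0 * O' 2 0 - O' 4 0 * E 2 0) / D"
  have l: "l * D = E 4 0 * O' 2 0 - O' 4 0 * E 2 0" using D0 by (simp add: l_def)
  fix x
  have "2 * T 4 x * T 0 x - 8 * T 3 x * T 1 x + 6 * (T 2 x)\<^sup>2 = O' 0 x * E 4 0 - E 0 x * O' 4 0"
    using theta_addition_dy4[of x 0] by (simp add: power2_eq_square algebra_simps)
  moreover have "D * (O' 0 x * E 4 0 - E 0 x * O' 4 0) =
     D * (l * (T 0 x)\<^sup>2 + m * (- 2 * theta_N x))"
    unfolding theta_square theta_N_eq using l m unfolding D_def by algebra
  ultimately show "2 * T 4 x * T 0 x - 8 * T 3 x * T 1 x + 6 * (T 2 x)\<^sup>2
      = l * (T 0 x)\<^sup>2 - 2 * m * theta_N x" using D0 by simp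
qed


text \<open>The logarithmic derivative of \<open>\<theta>\<close> and its negative derivative play the roles of Weierstrass'
  \<open>\<zeta>\<close> and \<open>\<wp>\<close>; they differ from these by a linear function and by a constant.\<close>

definition theta_zeta :: "real \<Rightarrow> real" where
  "theta_zeta x = T 1 x / T 0 x"

definition theta_wp :: "real \<Rightarrow> real" where
  "theta_wp x = theta_N x / (T 0 x)\<^sup>2"

text \<open>The sigma function formula \<open>wp'(x) = - sigma(2 x) / sigma(x)^4\<close>. In this
  form the nonvanishing and the logarithmic derivative can be read off.\<close>

definition theta_wp' :: "real \<Rightarrow> real" where
  "theta_wp' x = - (T 1 0 ^ 3 * T 0 (2 * x)) / T 0 x ^ 4"

lemma theta_zeta_deriv:
  assumes "T 0 x \<noteq> 0"
  shows "(theta_zeta has_real_derivative - theta_wp x) (at x)"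
  unfolding theta_zeta_def[abs_def] theta_wp_def theta_N_def
  by (rule derivative_eq_intros theta_derivs refl assms
      | (use assms in \<open>simp add: numeral_2_eq_2 field_simps\<close>))+

lemma theta_zeta_weight_one:
  assumes "T 0 (x + y) \<noteq> 0" "T 0 (x - y) \<noteq> 0" "T 0 x \<noteq> 0"
  shows "theta_zeta (x + y) + theta_zeta (x - y) - 2 * theta_zeta x =
    T 1 0 * T 0 (2 * x) * (T 0 y)\<^sup>2 / ((T 0 x)\<^sup>2 * (T 0 (x + y) * T 0 (x - y)))"
  unfolding theta_weight_one[symmetric] theta_zeta_def using assms
  by (simp add: field_simps power2_eq_square)

lemma theta_wp_diff:
  assumes "T 0 x \<noteq> 0" "T 0 y \<noteq> 0"
  shows "theta_wp x - theta_wp y =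
    - (T 1 0)\<^sup>2 * (T 0 (x + y) * T 0 (x - y)) / ((T 0 x)\<^sup>2 * (T 0 y)\<^sup>2)"
  unfolding theta_N_diff[symmetric] theta_wp_def using assms by (simp add: field_simps)

lemma isCont_theta: "isCont (T j) x"
  using theta_deriv[OF t] by (rule DERIV_isCont)

lemma open_theta_nonzero: "open {x. T 0 x \<noteq> 0}" "open {x. T 0 x \<noteq> 0 \<and> T 0 (2 * x) \<noteq> 0}"
proof -
  have c: "continuous_on UNIV (T 0)"
    using isCont_theta by (simp add: continuous_at_imp_continuous_on)
  have c2: "continuous_on UNIV (\<lambda>x. T 0 (2 * x))"
    by (rule continuous_on_compose2[OF c]) (auto intro: continuous_intros)
  show *: "open {x. T 0 x \<noteq> 0}"
    by (rule open_Collect_neq[OF c]) auto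
  have "open ({x. T 0 x \<noteq> 0} \<inter> {x. T 0 (2 * x) \<noteq> 0})"
    by (intro open_Int * open_Collect_neq c2) auto
  thus "open {x. T 0 x \<noteq> 0 \<and> T 0 (2 * x) \<noteq> 0}"
    by (simp add: Collect_conj_eq)
qed

text \<open>By \<open>theta_wp_diff\<close> the increment of \<open>theta_wp\<close> from
  \<open>x\<close> to \<open>y\<close> has the factor \<open>T 0 (y - x)\<close>. It vanishes at
  \<open>y = x\<close>, so only its own derivative \<open>T 1 0\<close> contributes.\<close>

lemma theta_wp_deriv:
  assumes x: "T 0 x \<noteq> 0"
  shows "(theta_wp has_real_derivative theta_wp' x) (at x)"
proof (rule has_field_derivative_transform_within_open[OF _ open_theta_nonzero(1)])
  show "((\<lambda>y. theta_wp x + - (T 1 0)\<^sup>2 * (T 0 (y + x) * T 0 (y - x)) / ((T 0 y)\<^sup>2 * (T 0 x)\<^sup>2))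
     has_real_derivative theta_wp' x) (at x)"
    unfolding theta_wp'_def
    by (rule derivative_eq_intros theta_derivs refl
        | (use x in \<open>simp add: theta_0 eval_nat_numeral field_simps\<close>))+
  show "theta_wp x + - (T 1 0)\<^sup>2 * (T 0 (y + x) * T 0 (y - x)) / ((T 0 y)\<^sup>2 * (T 0 x)\<^sup>2) = theta_wp y"
    if "y \<in> {x. T 0 x \<noteq> 0}" for y
    using theta_wp_diff[of y x] that x by simp
qed (use x in simp)

text \<open>The same derivative taken from the definition. It involves values at \<open>x\<close>
  alone, so one more derivative produces the combination with \<open>T 4 x\<close> of
  \<open>theta_quartic\<close>.\<close>

lemma theta_wp'_eq:
  assumes x: "T 0 x \<noteq> 0"
  shows "theta_wp' x = (3 * T 0 x * T 1 x * T 2 x - T 3 x * (T 0 x)\<^sup>2 - 2 * T 1 x ^ 3) / T 0 x ^ 3"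
proof (rule DERIV_unique[OF theta_wp_deriv[OF x]])
  show "(theta_wp has_real_derivative
      (3 * T 0 x * T 1 x * T 2 x - T 3 x * (T 0 x)\<^sup>2 - 2 * T 1 x ^ 3) / T 0 x ^ 3) (at x)"
    unfolding theta_wp_def[abs_def] theta_N_def
    by (rule derivative_eq_intros theta_derivs refl
        | (use x in \<open>simp add: eval_nat_numeral field_simps\<close>))+
qed

lemma theta_wp'_deriv:
  assumes x: "T 0 x \<noteq> 0" "T 0 (2 * x) \<noteq> 0"
  shows "(theta_wp' has_real_derivative theta_wp' x * (2 * theta_zeta (2 * x) - 4 * theta_zeta x)) (at x)"
  unfolding theta_wp'_def[abs_def] theta_zeta_def
  by (rule derivative_eq_intros theta_derivs refl
      | (use x in \<open>simp add: eval_nat_numeral field_simps\<close>))+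

text \<open>The analogue of \<open>wp'' = 6 wp^2 + const\<close>: the second derivative is computed
  once from the logarithmic derivative of the product form and once from the quotient form, reduced
  by \<open>theta_quartic\<close>. The linear term reflects the additive constant between
  \<open>theta_wp\<close> and Weierstrass' function.\<close>

lemma theta_wp_ode:
  assumes "T 1 0 \<noteq> 0"
  obtains l where "\<And>x. T 0 x \<noteq> 0 \<Longrightarrow> T 0 (2 * x) \<noteq> 0 \<Longrightarrow>
    theta_wp' x * (2 * theta_zeta (2 * x) - 4 * theta_zeta x) =
      6 * (theta_wp x)\<^sup>2 + 4 * T 3 0 / T 1 0 * theta_wp x + l"
proof -
  define m where "m = 4 * T 3 0 / T 1 0"
  obtain l where l: "\<And>x. 2 * T 4 x * T 0 x - 8 * T 3 x * T 1 x + 6 * (T 2 x)\<^sup>2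
      = l * (T 0 x)\<^sup>2 - 2 * m * theta_N x"
    using theta_quartic[OF assms] unfolding m_def by blast
  show ?thesis
  proof
    fix x assume x: "T 0 x \<noteq> 0" "T 0 (2 * x) \<noteq> 0"
    define P where "P = (\<lambda>x. (3 * T 0 x * T 1 x * T 2 x - T 3 x * (T 0 x)\<^sup>2 - 2 * T 1 x ^ 3) / T 0 x ^ 3)"
    define d where "d = (4 * T 3 x * T 1 x * (T 0 x)\<^sup>2 + 3 * (T 2 x)\<^sup>2 * (T 0 x)\<^sup>2
        - 12 * T 2 x * (T 1 x)\<^sup>2 * T 0 x - T 4 x * T 0 x ^ 3 + 6 * T 1 x ^ 4) / T 0 x ^ 4"
    have "(P has_real_derivative d) (at x)"
      unfolding P_def d_def
      by (rule derivative_eq_intros theta_derivs refl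
          | (use x in \<open>simp add: eval_nat_numeral field_simps\<close>))+
    hence "(theta_wp' has_real_derivative d) (at x)"
      by (rule has_field_derivative_transform_within_open[OF _ open_theta_nonzero(1)])
         (use x in \<open>auto simp: P_def theta_wp'_eq\<close>)
    hence "theta_wp' x * (2 * theta_zeta (2 * x) - 4 * theta_zeta x) = d"
      using theta_wp'_deriv[OF x] DERIV_unique by blast
    also have "d = 6 * (theta_wp x)\<^sup>2 - (2 * T 4 x * T 0 x - 8 * T 3 x * T 1 x + 6 * (T 2 x)\<^sup>2) / (2 * (T 0 x)\<^sup>2)"
      unfolding d_def theta_wp_def theta_N_def using x
      by (simp add: field_simps eval_nat_numeral)
    also have "\<dots> = 6 * (theta_wp x)\<^sup>2 + m * theta_wp x + - l / 2"
      unfolding l theta_wp_def using x by (simp add: field_simps)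
    finally show "theta_wp' x * (2 * theta_zeta (2 * x) - 4 * theta_zeta x) =
      6 * (theta_wp x)\<^sup>2 + 4 * T 3 0 / T 1 0 * theta_wp x + - l / 2"
      by (simp add: m_def)
  qed
qed

text \<open>The duplication formula \<open>wp(2 x) + 2 wp(x) = (zeta(2 x) - 2 zeta(x))^2\<close>. It
  follows by differentiating \<open>theta_wp_ode\<close>, which removes the unknown constant, and
  cancelling \<open>theta_wp' x\<close>.\<close>

theorem theta_zeta_square:
  assumes c: "T 1 0 \<noteq> 0" and x: "T 0 x \<noteq> 0" "T 0 (2 * x) \<noteq> 0"
  shows "(2 * theta_zeta (2 * x) - 4 * theta_zeta x)\<^sup>2 =
           8 * theta_wp x + 4 * theta_wp (2 * x) + 4 * T 3 0 / T 1 0"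
proof -
  define m where "m = 4 * T 3 0 / T 1 0"
  define R where "R = (\<lambda>x. 2 * theta_zeta (2 * x) - 4 * theta_zeta x)"
  obtain l where l: "\<And>x. T 0 x \<noteq> 0 \<Longrightarrow> T 0 (2 * x) \<noteq> 0 \<Longrightarrow>
    theta_wp' x * R x = 6 * (theta_wp x)\<^sup>2 + m * theta_wp x + l"
    using theta_wp_ode[OF c] unfolding m_def R_def by metis
  have "((\<lambda>x. theta_wp' x * R x) has_real_derivative
      theta_wp' x * R x * R x + theta_wp' x * (- 4 * theta_wp (2 * x) + 4 * theta_wp x)) (at x)"
    unfolding R_def
    by (rule derivative_eq_intros theta_wp'_deriv[OF x] theta_zeta_deriv[THEN DERIV_chain2] refl x
        | (simp add: algebra_simps))+
  moreover have "((\<lambda>x. theta_wp' x * R x) has_real_derivative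
      12 * theta_wp x * theta_wp' x + m * theta_wp' x) (at x)"
  proof (rule has_field_derivative_transform_within_open[OF _ open_theta_nonzero(2)])
    show "((\<lambda>x. 6 * (theta_wp x)\<^sup>2 + m * theta_wp x + l) has_real_derivative
        12 * theta_wp x * theta_wp' x + m * theta_wp' x) (at x)"
      by (rule derivative_eq_intros theta_wp_deriv[OF x(1)] refl | simp)+
  qed (use x l in auto)
  ultimately have "theta_wp' x * R x * R x + theta_wp' x * (- 4 * theta_wp (2 * x) + 4 * theta_wp x)
      = 12 * theta_wp x * theta_wp' x + m * theta_wp' x"
    by (rule DERIV_unique)
  hence "theta_wp' x * (R x)\<^sup>2 = theta_wp' x * (8 * theta_wp x + 4 * theta_wp (2 * x) + m)"
    by (simp add: algebra_simps power2_eq_square)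
  moreover have "theta_wp' x \<noteq> 0" using c x by (simp add: theta_wp'_def)
  ultimately show ?thesis unfolding R_def m_def by simp
qed

end

section \<open>Theta values at 5-torsion points\<close>

lemma euler_prod_ge:
  assumes q: "0 < q" "q < 1"
  shows "1 - q / (1 - q) \<le> euler_prod q"
proof (rule LIMSEQ_le_const[OF qfact_tendsto[OF q]], intro exI allI impI)
  fix n
  have "(\<Sum>i<n. q ^ Suc i) = q * (\<Sum>i<n. q ^ i)" by (simp add: sum_distrib_left)
  also have "\<dots> \<le> q * (1 / (1 - q))"
    using q by (intro mult_left_mono) (auto simp: sum_gp_strict divide_right_mono)
  finally have "1 - q / (1 - q) \<le> 1 - (\<Sum>i<n. q ^ Suc i)" by simp
  also have "\<dots> \<le> qfact q n"
    unfolding qfact_def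
  proof (rule Weierstrass_prod_ineq)
    show "q ^ Suc i \<in> {0..1}" for i
      using one_minus_power_bounds[OF q, of i] by auto
  qed
  finally show "1 - q / (1 - q) \<le> qfact q n" .
qed

lemma euler_prod_tendsto_1: "(euler_prod \<longlongrightarrow> 1) (at_right 0)"
proof (rule tendsto_sandwich)
  have *: "\<forall>\<^sub>F q::real in at_right 0. q \<in> {0<..<1}"
    by (rule eventually_at_right_real) simp
  show "\<forall>\<^sub>F q in at_right 0. 1 - q / (1 - q) \<le> euler_prod q"
    using * by (rule eventually_mono) (auto intro: euler_prod_ge)
  show "\<forall>\<^sub>F q in at_right 0. euler_prod q \<le> 1"
    using * by (rule eventually_mono) (auto intro: euler_prod_le_1)
  show "((\<lambda>q::real. 1 - q / (1 - q)) \<longlongrightarrow> 1) (at_right 0)"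
    by (rule tendsto_eq_intros refl | simp)+
qed simp

text \<open>The factors of the Euler product whose exponents are congruent to \<open>j\<close> or
  \<open>-j\<close> modulo 5. With the multiples of 5, the cases \<open>j = 1\<close> and
  \<open>j = 2\<close> exhaust all exponents.\<close>

definition class_prod :: "nat \<Rightarrow> real \<Rightarrow> nat \<Rightarrow> real" where
  "class_prod j q n = (\<Prod>i<n. (1 - q ^ (5 * i + j)) * (1 - q ^ (5 * i + 5 - j)))"

lemma class_prod_bounds:
  assumes q: "0 < q" "q < 1" and j: "0 < j" "j < 5"
  shows "0 < class_prod j q n" "class_prod j q n \<le> 1"
proof -
  have *: "0 < 1 - q ^ m" "1 - q ^ m \<le> 1" if m: "m > 0" for m
  proof -
    obtain k where "m = Suc k" using gr0_implies_Suc[OF m] by blast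
    thus "0 < 1 - q ^ m" "1 - q ^ m \<le> 1" using one_minus_power_bounds[OF q, of k] by auto
  qed
  show "0 < class_prod j q n"
    unfolding class_prod_def by (intro prod_pos ballI mult_pos_pos *) (use j in auto)
  show "class_prod j q n \<le> 1"
    unfolding class_prod_def
  proof (intro prod_le_1 conjI)
    fix i
    have i: "5 * i + j > 0" "5 * i + 5 - j > 0" using j by auto
    show "0 \<le> (1 - q ^ (5 * i + j)) * (1 - q ^ (5 * i + 5 - j))"
      using *(1)[OF i(1)] *(1)[OF i(2)] by simp
    show "(1 - q ^ (5 * i + j)) * (1 - q ^ (5 * i + 5 - j)) \<le> 1"
      using *[OF i(1)] *[OF i(2)] mult_mono[of "1 - q ^ (5 * i + j)" 1 "1 - q ^ (5 * i + 5 - j)" 1] by simp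
  qed
qed

lemma class_prod_mult: "class_prod 1 q n * class_prod 2 q n * qfact (q ^ 5) n = qfact q (5 * n)"
proof (induction n)
  case (Suc n)
  have "qfact q (5 * Suc n) = qfact q (5 * n) * ((1 - q ^ (5 * n + 1)) * (1 - q ^ (5 * n + 2)) *
      (1 - q ^ (5 * n + 3)) * (1 - q ^ (5 * n + 4)) * (1 - q ^ (5 * n + 5)))"
    by (simp add: qfact_def eval_nat_numeral)
  moreover have "5 * n + 5 - 1 = 5 * n + 4" "5 * n + 5 - 2 = 5 * n + 3" by simp_all
  hence "class_prod 1 q (Suc n) = class_prod 1 q n * ((1 - q ^ (5 * n + 1)) * (1 - q ^ (5 * n + 4)))"
    "class_prod 2 q (Suc n) = class_prod 2 q n * ((1 - q ^ (5 * n + 2)) * (1 - q ^ (5 * n + 3)))"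
    unfolding class_prod_def prod.lessThan_Suc by (simp_all only: mult.assoc)
  moreover have "(q ^ 5) ^ Suc n = q ^ (5 * n + 5)"
    by (simp add: power_mult[symmetric] power_add)
  hence "qfact (q ^ 5) (Suc n) = qfact (q ^ 5) n * (1 - q ^ (5 * n + 5))"
    by (simp add: qfact_def del: power_Suc)
  ultimately show ?case unfolding Suc[symmetric] by (simp only: mult_ac)
qed (simp add: class_prod_def qfact_def)

context
  fixes s :: real
  assumes s: "s > 0"
begin

private abbreviation "q \<equiv> exp (- 8 * s)"

lemma q_bounds: "0 < q" "q < 1" "0 < q ^ 5" "q ^ 5 < 1"
  using s by (auto simp: exp_of_nat_mult[symmetric])

lemma q5: "exp (- 8 * (5 * s)) = q ^ 5"
  unfolding exp_of_nat_mult[symmetric] by simp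

text \<open>The triple product with \<open>exp (- 8 t) = q ^ 5\<close> and
  \<open>exp (- 2 z) = q ^ j\<close>; the exponential prefactor undoes
  \<open>exp (z - t)\<close>.\<close>

lemma class_prod_tendsto:
  assumes j: "0 < j" "j < 5"
  shows "class_prod j q \<longlonglongrightarrow>
    exp ((5 - 4 * of_nat j) * s) * theta (5 * s) 0 (4 * of_nat j * s) / euler_prod (q ^ 5)"
proof -
  have f: "exp (- 2 * (4 * of_nat j * s)) * (q ^ 5) ^ i = q ^ (5 * i + j)"
     "exp (2 * (4 * of_nat j * s)) * (q ^ 5) ^ Suc i = q ^ (5 * i + 5 - j)" for i
    unfolding power_mult[symmetric] using j
    by (simp_all add: exp_of_nat_mult[symmetric] exp_add[symmetric] of_nat_diff algebra_simps del: power_Suc)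
  have "(\<lambda>n. exp (4 * of_nat j * s - 5 * s) * class_prod j q n) \<longlonglongrightarrow>
     theta (5 * s) 0 (4 * of_nat j * s) / euler_prod (q ^ 5)"
    using jacobi_triple_product[of "5 * s" "4 * of_nat j * s"] s
    unfolding q5 f class_prod_def by simp
  hence "(\<lambda>n. exp ((5 - 4 * of_nat j) * s) * (exp (4 * of_nat j * s - 5 * s) * class_prod j q n)) \<longlonglongrightarrow>
     exp ((5 - 4 * of_nat j) * s) * (theta (5 * s) 0 (4 * of_nat j * s) / euler_prod (q ^ 5))"
    by (intro tendsto_mult tendsto_const)
  moreover have "exp ((5 - 4 * of_nat j) * s) * exp (4 * of_nat j * s - 5 * s) = exp 0"
    unfolding exp_add[symmetric] by (rule arg_cong[of _ _ exp]) (simp add: algebra_simps)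
  hence "exp ((5 - 4 * of_nat j) * s) * (exp (4 * of_nat j * s - 5 * s) * x) = x" for x
    by (simp only: mult.assoc[symmetric] exp_zero mult_1_left)
  ultimately show ?thesis by simp
qed

private abbreviation "T1 \<equiv> theta (5 * s) 0 (4 * s)"
private abbreviation "T2 \<equiv> theta (5 * s) 0 (8 * s)"

lemma class_prod_tendsto_12:
  "class_prod 1 q \<longlonglongrightarrow> exp s * T1 / euler_prod (q ^ 5)"
  "class_prod 2 q \<longlonglongrightarrow> exp (- 3 * s) * T2 / euler_prod (q ^ 5)"
  using class_prod_tendsto[of 1] class_prod_tendsto[of 2] by simp_all

lemma theta_prod_12: "T1 * T2 = exp (2 * s) * euler_prod q * euler_prod (q ^ 5)"
proof -
  note E = euler_prod_pos[OF q_bounds(3,4)]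
  have "(\<lambda>n. class_prod 1 q n * class_prod 2 q n * qfact (q ^ 5) n) \<longlonglongrightarrow>
     exp s * T1 / euler_prod (q ^ 5) * (exp (- 3 * s) * T2 / euler_prod (q ^ 5)) * euler_prod (q ^ 5)"
    by (intro tendsto_mult class_prod_tendsto_12 qfact_tendsto q_bounds)
  moreover have "filterlim (\<lambda>n::nat. 5 * n) at_top sequentially"
    by (rule filterlim_subseq) (simp add: strict_mono_def)
  from filterlim_compose[OF qfact_tendsto[OF q_bounds(1,2)] this]
  have "(\<lambda>n. qfact q (5 * n)) \<longlonglongrightarrow> euler_prod q" .
  ultimately have "exp s * T1 / euler_prod (q ^ 5) * (exp (- 3 * s) * T2 / euler_prod (q ^ 5)) * euler_prod (q ^ 5)
     = euler_prod q"
    unfolding class_prod_mult by (rule LIMSEQ_unique)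
  moreover have "exp s * exp (- 3 * s) = exp (- 2 * s)" by (simp add: exp_add[symmetric])
  ultimately have "exp (- 2 * s) * (T1 * T2) = euler_prod q * euler_prod (q ^ 5)"
    using E by (simp add: divide_eq_eq mult_ac) (metis mult.assoc mult.left_commute)
  hence "exp (2 * s) * (exp (- 2 * s) * (T1 * T2)) = exp (2 * s) * (euler_prod q * euler_prod (q ^ 5))"
    by simp
  thus ?thesis by (simp add: mult.assoc[symmetric] exp_add[symmetric])
qed

text \<open>A limit of positive products is only nonnegative; \<open>theta_prod_12\<close> excludes
  zero and transfers the sign from one factor to the other.\<close>

lemma theta_12_pos: "T1 > 0" "T2 > 0"
proof -
  have "T1 * T2 > 0"
    unfolding theta_prod_12 by (intro mult_pos_pos euler_prod_pos q_bounds) simp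
  moreover have "exp s * T1 / euler_prod (q ^ 5) \<ge> 0"
    by (rule LIMSEQ_le_const[OF class_prod_tendsto_12(1)])
       (use class_prod_bounds(1)[OF q_bounds(1,2), of 1] in \<open>auto simp: less_imp_le\<close>)
  hence "T1 \<ge> 0"
    using euler_prod_pos[OF q_bounds(3,4)] by (simp add: zero_le_divide_iff zero_le_mult_iff)
  ultimately show "T1 > 0" "T2 > 0" by (auto simp: zero_less_mult_iff)
qed

text \<open>Both quantities are at most 1 and their product is at least \<open>euler_prod q\<close>,
  so each of them is. This squeezes both to 1 as \<open>q\<close> tends to 0.\<close>

lemma normalized_theta_bounds:
  "euler_prod q \<le> exp s * T1 / euler_prod (q ^ 5)" "exp s * T1 / euler_prod (q ^ 5) \<le> 1"
  "euler_prod q \<le> exp (- 3 * s) * T2 / euler_prod (q ^ 5)" "exp (- 3 * s) * T2 / euler_prod (q ^ 5) \<le> 1"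
proof -
  define x y where "x = exp s * T1 / euler_prod (q ^ 5)" and "y = exp (- 3 * s) * T2 / euler_prod (q ^ 5)"
  note E = euler_prod_pos[OF q_bounds(3,4)]
  have pos: "x > 0" "y > 0" using theta_12_pos E by (auto simp: x_def y_def)
  have x1: "x \<le> 1" unfolding x_def
    by (rule LIMSEQ_le_const2[OF class_prod_tendsto_12(1)])
       (use class_prod_bounds(2)[OF q_bounds(1,2), of 1] in auto)
  have y1: "y \<le> 1" unfolding y_def
    by (rule LIMSEQ_le_const2[OF class_prod_tendsto_12(2)])
       (use class_prod_bounds(2)[OF q_bounds(1,2), of 2] in auto)
  have "x * y = (exp s * exp (- 3 * s)) * (T1 * T2) / (euler_prod (q ^ 5))\<^sup>2"
    unfolding x_def y_def by (simp add: power2_eq_square)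
  also have "\<dots> = (exp s * exp (- 3 * s) * exp (2 * s)) * (euler_prod q * euler_prod (q ^ 5)) / (euler_prod (q ^ 5))\<^sup>2"
    unfolding theta_prod_12 by (simp only: mult.assoc)
  also have "exp s * exp (- 3 * s) * exp (2 * s) = 1" by (simp add: exp_add[symmetric])
  also have "1 * (euler_prod q * euler_prod (q ^ 5)) / (euler_prod (q ^ 5))\<^sup>2 = euler_prod q / euler_prod (q ^ 5)"
    using E by (simp add: power2_eq_square)
  also have "\<dots> \<ge> euler_prod q"
    using euler_prod_le_1[OF q_bounds(3,4)] euler_prod_pos[OF q_bounds(1,2)] E by (simp add: field_simps)
  finally have xy: "euler_prod q \<le> x * y" .
  show "euler_prod q \<le> x" "x \<le> 1" "euler_prod q \<le> y" "y \<le> 1"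
    using xy x1 y1 mult_left_le[OF y1 less_imp_le[OF pos(1)]] mult_left_le[OF x1 less_imp_le[OF pos(2)]]
    unfolding mult.commute[of y x] by linarith+
qed

end

section \<open>The differential equation of the Hauptmodul\<close>

lemma theta_shift_1:
  assumes t: "t > 0"
  shows "theta t 1 (z + 4 * t) = - exp (4 * t + 2 * z) * (theta t 1 z + 2 * theta t 0 z)"
proof -
  have "((\<lambda>z. theta t 0 (z + 4 * t)) has_real_derivative theta t 1 (z + 4 * t)) (at z)"
    by (rule DERIV_cong, (rule derivative_eq_intros theta_derivs[OF t] refl | simp)+)
  moreover have "((\<lambda>z. - exp (4 * t + 2 * z) * theta t 0 z) has_real_derivative
      - exp (4 * t + 2 * z) * (theta t 1 z + 2 * theta t 0 z)) (at z)"
    by (rule derivative_eq_intros theta_derivs[OF t] refl | simp add: algebra_simps)+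
  ultimately show ?thesis unfolding theta_shift by (rule DERIV_unique)
qed

lemma theta_shift_2:
  assumes t: "t > 0"
  shows "theta t 2 (z + 4 * t) = - exp (4 * t + 2 * z) * (theta t 2 z + 4 * theta t 1 z + 4 * theta t 0 z)"
proof -
  have "((\<lambda>z. theta t 1 (z + 4 * t)) has_real_derivative theta t 2 (z + 4 * t)) (at z)"
    by (rule DERIV_cong, (rule derivative_eq_intros theta_derivs[OF t] refl | simp add: numeral_2_eq_2)+)
  moreover have "((\<lambda>z. - exp (4 * t + 2 * z) * (theta t 1 z + 2 * theta t 0 z)) has_real_derivative
      - exp (4 * t + 2 * z) * (theta t 2 z + 4 * theta t 1 z + 4 * theta t 0 z)) (at z)"
    by (rule derivative_eq_intros theta_derivs[OF t] refl | simp add: numeral_2_eq_2 algebra_simps)+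
  ultimately show ?thesis unfolding theta_shift_1[OF t] by (rule DERIV_unique)
qed

lemma theta_zeta_shift:
  assumes "t > 0" "theta t 0 z \<noteq> 0"
  shows "theta_zeta t (z + 4 * t) = theta_zeta t z + 2"
  using assms unfolding theta_zeta_def[OF assms(1)] theta_shift_1[OF assms(1)] theta_shift
  by (simp add: field_simps)

lemma theta_wp_shift:
  assumes "t > 0"
  shows "theta_wp t (z + 4 * t) = theta_wp t z"
proof -
  define e where "e = - exp (4 * t + 2 * z)"
  have e: "e \<noteq> 0" by (simp add: e_def)
  have "theta_N t (z + 4 * t) = e\<^sup>2 * theta_N t z"
    unfolding theta_N_def[OF assms] theta_shift_1[OF assms] theta_shift_2[OF assms] theta_shift e_def[symmetric]
    by algebra
  moreover have "(theta t 0 (z + 4 * t))\<^sup>2 = e\<^sup>2 * (theta t 0 z)\<^sup>2"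
    unfolding theta_shift e_def[symmetric] by algebra
  ultimately show ?thesis using e by (simp add: theta_wp_def[OF assms])
qed

lemma theta_zeta_minus: "t > 0 \<Longrightarrow> theta_zeta t (- z) = - theta_zeta t z"
  by (simp add: theta_zeta_def theta_minus)

lemma theta_wp_minus: "t > 0 \<Longrightarrow> theta_wp t (- z) = theta_wp t z"
  by (simp add: theta_wp_def theta_N_def theta_minus)


text \<open>The parametrisation is \<open>q = exp (- 8 s)\<close>, so that the theta functions with modulus \<open>5 s\<close>
  have squared nome \<open>q\<^sup>5\<close> and the arguments \<open>4 s\<close>, \<open>8 s\<close> correspond to \<open>q\<close> and \<open>q\<^sup>2\<close>.\<close>

definition th0 :: "real \<Rightarrow> real" where "th0 s = theta (5 * s) 1 0"
definition th1 :: "real \<Rightarrow> real" where "th1 s = theta (5 * s) 0 (4 * s)"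
definition th2 :: "real \<Rightarrow> real" where "th2 s = theta (5 * s) 0 (8 * s)"

text \<open>\<open>eis_a\<close> and \<open>eis_b\<close> are twice the usual generators of the modular forms for \<open>\<Gamma>\<^sub>1(5)\<close>, \<open>rr5\<close> is
  \<open>R(q)\<^sup>5\<close> and \<open>haupt\<close> is \<open>(\<eta>(5\<tau>) / \<eta>(\<tau>))\<^sup>6\<close>.\<close>

definition eis_a :: "real \<Rightarrow> real" where
  "eis_a s = th0 s * exp (- 4 * s) * (th2 s)\<^sup>2 / th1 s ^ 3"
definition eis_b :: "real \<Rightarrow> real" where
  "eis_b s = th0 s * exp (8 * s) * (th1 s)\<^sup>2 / th2 s ^ 3"
definition rr5 :: "real \<Rightarrow> real" where
  "rr5 s = exp (12 * s) * th1 s ^ 5 / th2 s ^ 5"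
definition haupt :: "real \<Rightarrow> real" where
  "haupt s = exp (24 * s) * th0 s ^ 4 / (16 * th1 s ^ 6 * th2 s ^ 6)"

context
  fixes s :: real
  assumes s: "s > 0"
begin

private abbreviation "qs \<equiv> exp (- 8 * s)"
private abbreviation "Z \<equiv> theta_zeta (5 * s)"
private abbreviation "p \<equiv> theta_wp (5 * s)"

private lemma s5: "5 * s > 0" using s by simp

lemma th_pos: "th0 s > 0" "th1 s > 0" "th2 s > 0"
proof -
  show "th0 s > 0"
    unfolding th0_def jacobi_euler_cube[OF s5] q5[OF s]
    using euler_prod_pos[OF q_bounds(3,4)[OF s]] by simp
  show "th1 s > 0" "th2 s > 0"
    using theta_12_pos[OF s] by (simp_all add: th1_def th2_def)
qed

text \<open>With modulus \<open>5 s\<close> the quasi-period is \<open>20 s\<close>, and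
  \<open>12 s = 20 s - 8 s\<close>, \<open>16 s = 20 s - 4 s\<close>: sums and doubles of the two
  torsion points fold back to them by oddness.\<close>

lemma th_shifted:
  "theta (5 * s) 0 (12 * s) = exp (4 * s) * th2 s"
  "theta (5 * s) 0 (16 * s) = exp (12 * s) * th1 s"
  "Z (12 * s) = 2 - Z (8 * s)" "Z (16 * s) = 2 - Z (4 * s)" "p (16 * s) = p (4 * s)"
proof -
  have a: "12 * s = - (8 * s) + 4 * (5 * s)" "16 * s = - (4 * s) + 4 * (5 * s)" by simp_all
  show "theta (5 * s) 0 (12 * s) = exp (4 * s) * th2 s"
    "theta (5 * s) 0 (16 * s) = exp (12 * s) * th1 s"
    unfolding a theta_shift theta_minus th1_def th2_def by simp_all
  have nz: "theta (5 * s) 0 (- (8 * s)) \<noteq> 0" "theta (5 * s) 0 (- (4 * s)) \<noteq> 0"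
    using th_pos(2,3) by (simp_all add: theta_minus th1_def th2_def)
  show "Z (12 * s) = 2 - Z (8 * s)" "Z (16 * s) = 2 - Z (4 * s)" "p (16 * s) = p (4 * s)"
    unfolding a theta_zeta_shift[OF s5 nz(1)] theta_zeta_shift[OF s5 nz(2)] theta_wp_shift[OF s5]
      theta_zeta_minus[OF s5] theta_wp_minus[OF s5] by simp_all
qed

text \<open>\<open>theta_zeta_weight_one\<close> at \<open>x = 4 s\<close>, \<open>y = 8 s\<close>,
  where every theta value folds to \<open>th1 s\<close> or \<open>th2 s\<close>. The constant 2 is
  the increment of zeta over the quasi-period. Exchanging the two points gives
  \<open>eis_b_eq\<close>.\<close>

lemma eis_a_eq: "3 * Z (4 * s) + Z (8 * s) - 2 = eis_a s"
proof -
  have m: "theta (5 * s) 0 (- (4 * s)) = - th1 s" by (simp add: theta_minus th1_def)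
  have e: "exp (- 4 * s) = 1 / exp (4 * s)" by (simp add: exp_minus field_simps)
  have *: "4 * s + 8 * s = 12 * s" "4 * s - 8 * s = - (4 * s)" "2 * (4 * s) = 8 * s" by simp_all
  have "Z (12 * s) + Z (- (4 * s)) - 2 * Z (4 * s) =
      th0 s * th2 s * (th2 s)\<^sup>2 / ((th1 s)\<^sup>2 * (exp (4 * s) * th2 s * - th1 s))"
    using theta_zeta_weight_one[OF s5, of "4 * s" "8 * s"] th_pos
    unfolding * m th_shifted th0_def[symmetric] th1_def[symmetric] th2_def[symmetric] by simp
  also have "\<dots> = - eis_a s"
    unfolding eis_a_def e using th_pos by (simp add: field_simps eval_nat_numeral)
  finally show ?thesis unfolding th_shifted theta_zeta_minus[OF s5] by simp
qed

lemma eis_b_eq: "2 + Z (4 * s) - 3 * Z (8 * s) = eis_b s"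
proof -
  have e: "exp (12 * s) = exp (8 * s) * exp (4 * s)" by (simp add: exp_add[symmetric])
  have *: "8 * s + 4 * s = 12 * s" "8 * s - 4 * s = 4 * s" "2 * (8 * s) = 16 * s" by simp_all
  have "Z (12 * s) + Z (4 * s) - 2 * Z (8 * s) =
      th0 s * (exp (12 * s) * th1 s) * (th1 s)\<^sup>2 / ((th2 s)\<^sup>2 * (exp (4 * s) * th2 s * th1 s))"
    using theta_zeta_weight_one[OF s5, of "8 * s" "4 * s"] th_pos
    unfolding * th_shifted th0_def[symmetric] th1_def[symmetric] th2_def[symmetric] by simp
  also have "\<dots> = eis_b s"
    unfolding eis_b_def e using th_pos by (simp add: field_simps eval_nat_numeral)
  finally show ?thesis unfolding th_shifted by simp
qed

lemma eis_ab: "eis_a s * eis_b s = (th0 s)\<^sup>2 * exp (4 * s) / (th1 s * th2 s)"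
proof -
  have e: "exp (8 * s) = exp (4 * s) * exp (4 * s)" "exp (- 4 * s) = 1 / exp (4 * s)"
    by (simp_all add: exp_add[symmetric] exp_minus field_simps)
  show ?thesis unfolding eis_a_def eis_b_def e using th_pos by (simp add: field_simps eval_nat_numeral)
qed

text \<open>This makes the wp terms in the derivative of \<open>rr5\<close> quadratic in
  \<open>eis_a\<close> and \<open>eis_b\<close>, like its zeta terms.\<close>

lemma wp_diff_eq: "p (4 * s) - p (8 * s) = eis_a s * eis_b s"
proof -
  have m: "theta (5 * s) 0 (- (4 * s)) = - th1 s" by (simp add: theta_minus th1_def)
  have *: "4 * s + 8 * s = 12 * s" "4 * s - 8 * s = - (4 * s)" by simp_all
  have "p (4 * s) - p (8 * s) = - (th0 s)\<^sup>2 * (exp (4 * s) * th2 s * - th1 s) / ((th1 s)\<^sup>2 * (th2 s)\<^sup>2)"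
    using theta_wp_diff[OF s5, of "4 * s" "8 * s"] th_pos
    unfolding * m th_shifted th0_def[symmetric] th1_def[symmetric] th2_def[symmetric] by simp
  thus ?thesis unfolding eis_ab using th_pos by (simp add: field_simps eval_nat_numeral)
qed

lemma rr5_eis: "eis_a s * rr5 s = eis_b s"
proof -
  have e: "exp (12 * s) = exp (8 * s) * exp (4 * s)" "exp (- 4 * s) = 1 / exp (4 * s)"
    by (simp_all add: exp_add[symmetric] exp_minus field_simps)
  show ?thesis unfolding eis_a_def eis_b_def rr5_def e using th_pos by (simp add: field_simps eval_nat_numeral)
qed

text \<open>The heat equation along \<open>t = 5 s\<close>, \<open>z = 4 s\<close>, with the
  quotient of the second derivative by theta written as zeta squared minus wp.\<close>

lemma th1_deriv: "(th1 has_real_derivative th1 s * (4 * Z (4 * s) - 5 * ((Z (4 * s))\<^sup>2 - p (4 * s)))) (at s)"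
proof -
  have "(th1 has_real_derivative 4 * theta (5 * s) 1 (4 * s) - 5 * theta (5 * s) 2 (4 * s)) (at s)"
    using theta_deriv_line[OF s5, of 0 4] unfolding th1_def[abs_def] by (simp add: numeral_2_eq_2)
  also have "4 * theta (5 * s) 1 (4 * s) - 5 * theta (5 * s) 2 (4 * s)
      = th1 s * (4 * Z (4 * s) - 5 * ((Z (4 * s))\<^sup>2 - p (4 * s)))"
    using th_pos(2) unfolding theta_zeta_def[OF s5] theta_wp_def[OF s5] theta_N_def[OF s5] th1_def
    by (simp add: field_simps power2_eq_square)
  finally show ?thesis .
qed

lemma th2_deriv: "(th2 has_real_derivative th2 s * (8 * Z (8 * s) - 5 * ((Z (8 * s))\<^sup>2 - p (8 * s)))) (at s)"
proof -
  have "(th2 has_real_derivative 8 * theta (5 * s) 1 (8 * s) - 5 * theta (5 * s) 2 (8 * s)) (at s)"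
    using theta_deriv_line[OF s5, of 0 8] unfolding th2_def[abs_def] by (simp add: numeral_2_eq_2)
  also have "8 * theta (5 * s) 1 (8 * s) - 5 * theta (5 * s) 2 (8 * s)
      = th2 s * (8 * Z (8 * s) - 5 * ((Z (8 * s))\<^sup>2 - p (8 * s)))"
    using th_pos(3) unfolding theta_zeta_def[OF s5] theta_wp_def[OF s5] theta_N_def[OF s5] th2_def
    by (simp add: field_simps power2_eq_square)
  finally show ?thesis .
qed

lemma th0_deriv: "(th0 has_real_derivative th0 s * (- 5 * (theta (5 * s) 3 0 / th0 s))) (at s)"
  using theta_deriv_line[OF s5, of 1 0] th_pos(1) unfolding th0_def[abs_def] by (simp add: numeral_3_eq_3)

text \<open>Origin of the 11: with \<open>a\<close>, \<open>b\<close> for the Eisenstein series, the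
  wp terms contribute \<open>25 a b\<close> by \<open>wp_diff_eq\<close>, and the rest, a quadratic
  polynomial in the zeta values, equals \<open>- 2 a^2 + 2 b^2 - 3 a b\<close>. The total
  coefficient of \<open>a b\<close> is \<open>22 = 2 * 11\<close>.\<close>

lemma rr5_deriv:
  "(rr5 has_real_derivative
     rr5 s * (- 2 * ((eis_a s)\<^sup>2 - 11 * (eis_a s * eis_b s) - (eis_b s)\<^sup>2))) (at s)"
proof -
  define x y where "x = Z (4 * s)" and "y = Z (8 * s)"
  define D1 D2 where "D1 = 4 * x - 5 * (x\<^sup>2 - p (4 * s))" and "D2 = 8 * y - 5 * (y\<^sup>2 - p (8 * s))"
  have "(rr5 has_real_derivative rr5 s * (12 + 5 * D1 - 5 * D2)) (at s)"
    unfolding rr5_def[abs_def]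
    by (rule DERIV_cong, (rule derivative_eq_intros refl th1_deriv[folded x_def y_def, folded D1_def D2_def]
          th2_deriv[folded x_def y_def, folded D1_def D2_def] | (use th_pos in \<open>simp add: field_simps eval_nat_numeral\<close>))+)
  also have "12 + 5 * D1 - 5 * D2 =
      - 2 * ((eis_a s)\<^sup>2 - 11 * (eis_a s * eis_b s) - (eis_b s)\<^sup>2)"
  proof -
    have "12 + 5 * D1 - 5 * D2 = 12 + 20 * x - 40 * y - 25 * (x\<^sup>2 - y\<^sup>2) + 25 * (p (4 * s) - p (8 * s))"
      by (simp add: D1_def D2_def algebra_simps)
    thus ?thesis unfolding wp_diff_eq unfolding eis_a_eq[symmetric] eis_b_eq[symmetric] x_def y_def
      by (simp add: algebra_simps power2_eq_square)
  qed
  finally show ?thesis .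
qed

text \<open>\<open>D0\<close> carries the third derivative of theta at 0. The sum of
  \<open>theta_zeta_square\<close> at \<open>4 s\<close> and \<open>8 s\<close> contains it together
  with \<open>p (4 * s) + p (8 * s)\<close>, in the proportion needed to cancel both.\<close>

lemma haupt_deriv:
  "(haupt has_real_derivative haupt s * (- 2 * ((eis_a s)\<^sup>2 + (eis_b s)\<^sup>2))) (at s)"
proof -
  define x y where "x = Z (4 * s)" and "y = Z (8 * s)"
  define D0 D1 D2 where "D0 = - 5 * (theta (5 * s) 3 0 / th0 s)"
    and "D1 = 4 * x - 5 * (x\<^sup>2 - p (4 * s))" and "D2 = 8 * y - 5 * (y\<^sup>2 - p (8 * s))"
  have "(haupt has_real_derivative haupt s * (24 + 4 * D0 - 6 * D1 - 6 * D2)) (at s)"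
    unfolding haupt_def[abs_def]
    by (rule DERIV_cong, (rule derivative_eq_intros refl th0_deriv[folded D0_def]
          th1_deriv[folded x_def y_def, folded D1_def D2_def]
          th2_deriv[folded x_def y_def, folded D1_def D2_def] | (use th_pos in \<open>simp add: field_simps eval_nat_numeral\<close>))+)
  also have "24 + 4 * D0 - 6 * D1 - 6 * D2 = - 2 * ((eis_a s)\<^sup>2 + (eis_b s)\<^sup>2)"
  proof -
    have nz: "theta (5 * s) 1 0 \<noteq> 0" "theta (5 * s) 0 (4 * s) \<noteq> 0" "theta (5 * s) 0 (8 * s) \<noteq> 0"
      "theta (5 * s) 0 (16 * s) \<noteq> 0"
      using th_pos unfolding th_shifted by (simp_all add: th0_def th1_def th2_def)
    have *: "2 * (4 * s) = 8 * s" "2 * (8 * s) = 16 * s" by simp_all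
    have 1: "(2 * y - 4 * x)\<^sup>2 = 8 * p (4 * s) + 4 * p (8 * s) - 4 / 5 * D0"
      using theta_zeta_square[OF s5 nz(1,2)] nz(3) unfolding * x_def y_def D0_def th0_def by simp
    have 2: "(2 * (2 - x) - 4 * y)\<^sup>2 = 8 * p (8 * s) + 4 * p (4 * s) - 4 / 5 * D0"
      using theta_zeta_square[OF s5 nz(1,3)] nz(4) unfolding * th_shifted x_def y_def D0_def th0_def by simp
    show ?thesis
      using 1 2 unfolding eis_a_eq[symmetric] eis_b_eq[symmetric] D1_def D2_def x_def[symmetric] y_def[symmetric]
      by (simp add: algebra_simps power2_eq_square)
  qed
  finally show ?thesis .
qed


section \<open>Expressions in terms of the Euler product\<close>

lemma th0_q: "th0 s = 2 * exp (- 5 * s) * euler_prod (qs ^ 5) ^ 3"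
  unfolding th0_def jacobi_euler_cube[OF s5] q5[OF s] by simp

lemma th12_q: "th1 s * th2 s = exp (2 * s) * euler_prod qs * euler_prod (qs ^ 5)"
  using theta_prod_12[OF s] by (simp add: th1_def th2_def)

lemma haupt_q: "haupt s = qs * (euler_prod (qs ^ 5) / euler_prod qs) ^ 6"
proof -
  note E = euler_prod_pos[OF q_bounds(1,2)[OF s]] euler_prod_pos[OF q_bounds(3,4)[OF s]]
  have e: "exp (24 * s) * exp (- 5 * s) ^ 4 = qs * exp (2 * s) ^ 6"
    unfolding exp_of_nat_mult[symmetric] exp_add[symmetric] by simp
  have "haupt s = exp (24 * s) * th0 s ^ 4 / (16 * (th1 s * th2 s) ^ 6)"
    unfolding haupt_def by (simp add: power_mult_distrib mult_ac)
  also have "\<dots> = (exp (24 * s) * exp (- 5 * s) ^ 4) * euler_prod (qs ^ 5) ^ 12 /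
      (exp (2 * s) ^ 6 * (euler_prod qs ^ 6 * euler_prod (qs ^ 5) ^ 6))"
    unfolding th0_q th12_q by (simp add: power_mult_distrib power_mult[symmetric])
  also have "\<dots> = qs * (euler_prod (qs ^ 5) / euler_prod qs) ^ 6"
    unfolding e using E by (simp add: field_simps power_divide)
  finally show ?thesis .
qed

lemma eis_ab_q: "eis_a s * eis_b s = 4 * (qs * euler_prod (qs ^ 5) ^ 5 / euler_prod qs)"
proof -
  note E = euler_prod_pos[OF q_bounds(1,2)[OF s]] euler_prod_pos[OF q_bounds(3,4)[OF s]]
  have e: "exp (- 5 * s) ^ 2 * exp (4 * s) = qs * exp (2 * s)"
    unfolding exp_of_nat_mult[symmetric] exp_add[symmetric] by simp
  have "eis_a s * eis_b s = 4 * ((exp (- 5 * s) ^ 2 * exp (4 * s)) * euler_prod (qs ^ 5) ^ 6 /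
      (exp (2 * s) * (euler_prod qs * euler_prod (qs ^ 5))))"
    unfolding eis_ab th0_q th12_q by (simp add: power_mult_distrib power_mult[symmetric] mult_ac)
  also have "\<dots> = 4 * (qs * euler_prod (qs ^ 5) ^ 5 / euler_prod qs)"
    unfolding e using E by (simp add: field_simps) (simp add: eval_nat_numeral)
  finally show ?thesis .
qed

text \<open>The limits of \<open>class_prod 1\<close> and \<open>class_prod 2\<close>; in these
  terms \<open>rr5_q\<close> is the product formula for the fifth power of the Rogers-Ramanujan
  continued fraction.\<close>

definition norm_th1 :: real where "norm_th1 = exp s * th1 s / euler_prod (qs ^ 5)"
definition norm_th2 :: real where "norm_th2 = exp (- 3 * s) * th2 s / euler_prod (qs ^ 5)"

lemma norm_th_bounds:
  "euler_prod qs \<le> norm_th1" "norm_th1 \<le> 1" "euler_prod qs \<le> norm_th2" "norm_th2 \<le> 1"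
  using normalized_theta_bounds[OF s] by (simp_all add: norm_th1_def norm_th2_def th1_def th2_def)

lemma rr5_q: "rr5 s = qs * (norm_th1 ^ 5 / norm_th2 ^ 5)"
proof -
  note E = euler_prod_pos[OF q_bounds(3,4)[OF s]]
  have "exp (12 * s) * exp (- 3 * s) ^ 5 = qs * exp s ^ 5"
    unfolding exp_of_nat_mult[symmetric] exp_add[symmetric] by simp
  hence e: "exp (12 * s) = qs * exp s ^ 5 / exp (- 3 * s) ^ 5" by (simp add: field_simps)
  show ?thesis
    unfolding rr5_def e norm_th1_def norm_th2_def using E
    by (simp add: power_mult_distrib power_divide)
qed

lemma rr5_pos: "rr5 s > 0"
  unfolding rr5_def using th_pos by simp

lemma haupt_pos: "haupt s > 0"
  unfolding haupt_def using th_pos by simp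

text \<open>With \<open>b = a v\<close> the equation for \<open>v\<close> has the factor
  \<open>1 - 11 v - v^2\<close>, which is also the numerator of \<open>1 / v - 11 - v\<close>. Hence
  the latter has logarithmic derivative \<open>2 (a^2 + b^2)\<close>, opposite to that of
  \<open>haupt\<close>.\<close>

lemma haupt_rr5_deriv:
  "((\<lambda>s. (1 / rr5 s - 11 - rr5 s) * haupt s) has_real_derivative 0) (at s)"
proof -
  have r: "rr5 s \<noteq> 0" using rr5_pos by simp
  have "((\<lambda>s. (1 / rr5 s - 11 - rr5 s) * haupt s) has_real_derivative
     (- (rr5 s * (- 2 * ((eis_a s)\<^sup>2 - 11 * (eis_a s * eis_b s) - (eis_b s)\<^sup>2))) / (rr5 s * rr5 s)
      - rr5 s * (- 2 * ((eis_a s)\<^sup>2 - 11 * (eis_a s * eis_b s) - (eis_b s)\<^sup>2))) * haupt s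
      + (1 / rr5 s - 11 - rr5 s) * (haupt s * (- 2 * ((eis_a s)\<^sup>2 + (eis_b s)\<^sup>2)))) (at s)"
    by (rule DERIV_cong, (rule derivative_eq_intros refl rr5_deriv haupt_deriv r)+) simp
  also have "(- (rr5 s * (- 2 * ((eis_a s)\<^sup>2 - 11 * (eis_a s * eis_b s) - (eis_b s)\<^sup>2))) / (rr5 s * rr5 s)
      - rr5 s * (- 2 * ((eis_a s)\<^sup>2 - 11 * (eis_a s * eis_b s) - (eis_b s)\<^sup>2))) * haupt s
      + (1 / rr5 s - 11 - rr5 s) * (haupt s * (- 2 * ((eis_a s)\<^sup>2 + (eis_b s)\<^sup>2))) = 0"
    unfolding rr5_eis[symmetric] using r by (simp add: field_simps) algebra
  finally show ?thesis .
qed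

end

section \<open>The limit at \<open>q = 0\<close> and the algebraic relation\<close>

lemma exp_8_at_top: "filterlim (\<lambda>s::real. exp (- 8 * s)) (at_right 0) at_top"
  by real_asymp

lemma exp_8_5_at_top: "filterlim (\<lambda>s::real. exp (- 8 * s) ^ 5) (at_right 0) at_top"
  unfolding exp_of_nat_mult[symmetric] by real_asymp

text \<open>\<open>1 / rr5\<close> diverges while \<open>haupt\<close> tends to 0. Writing
  \<open>haupt\<close> as \<open>r\<close> times a factor tending to 1 cancels the pole before the
  limit is taken.\<close>

lemma haupt_rr5_tendsto: "((\<lambda>s. (1 / rr5 s - 11 - rr5 s) * haupt s) \<longlongrightarrow> 1) at_top"
proof -
  note E1 = filterlim_compose[OF euler_prod_tendsto_1 exp_8_at_top]
  note E5 = filterlim_compose[OF euler_prod_tendsto_1 exp_8_5_at_top]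
  have pos: "\<forall>\<^sub>F s::real in at_top. s > 0" by (rule eventually_gt_at_top)
  have n1: "(norm_th1 \<longlongrightarrow> 1) at_top" and n2: "(norm_th2 \<longlongrightarrow> 1) at_top"
    by (rule tendsto_sandwich[OF _ _ E1 tendsto_const];
        use pos in \<open>eventually_elim\<close>; use norm_th_bounds in blast)+
  define r where "r = (\<lambda>s. exp (- 8 * s) * (norm_th1 s ^ 5 / norm_th2 s ^ 5))"
  have "((\<lambda>s::real. exp (- 8 * s)) \<longlongrightarrow> 0) at_top"
    using exp_8_at_top by (simp add: filterlim_at)
  hence "(r \<longlongrightarrow> 0 * (1 ^ 5 / 1 ^ 5)) at_top"
    unfolding r_def by (intro tendsto_intros n1 n2) auto
  hence r: "(r \<longlongrightarrow> 0) at_top" by simp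
  have "((\<lambda>s. (1 - 11 * r s - (r s)\<^sup>2) * ((norm_th2 s ^ 5 / norm_th1 s ^ 5)
          * (euler_prod (exp (- 8 * s) ^ 5) / euler_prod (exp (- 8 * s))) ^ 6)) \<longlongrightarrow>
       (1 - 11 * 0 - 0\<^sup>2) * ((1 ^ 5 / 1 ^ 5) * (1 / 1) ^ 6)) at_top"
    by (intro tendsto_intros n1 n2 r E1 E5) auto
  moreover have "\<forall>\<^sub>F s in at_top. (1 - 11 * r s - (r s)\<^sup>2) * ((norm_th2 s ^ 5 / norm_th1 s ^ 5)
      * (euler_prod (exp (- 8 * s) ^ 5) / euler_prod (exp (- 8 * s))) ^ 6)
      = (1 / rr5 s - 11 - rr5 s) * haupt s"
    using pos
  proof eventually_elim
    case (elim s)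
    have n: "norm_th1 s > 0" "norm_th2 s > 0"
      using norm_th_bounds(1,3)[OF elim] euler_prod_pos[OF q_bounds(1,2)[OF elim]] by linarith+
    have rr: "rr5 s = r s" using rr5_q[OF elim] by (simp add: r_def)
    have r0: "r s > 0" using rr5_pos[OF elim] rr by simp
    define X where "X = (euler_prod (exp (- 8 * s) ^ 5) / euler_prod (exp (- 8 * s))) ^ 6"
    have "haupt s = r s * ((norm_th2 s ^ 5 / norm_th1 s ^ 5) * X)"
      unfolding haupt_q[OF elim] X_def[symmetric] r_def using n by simp
    moreover have "(1 / r s - 11 - r s) * (r s * Y) = (1 - 11 * r s - (r s)\<^sup>2) * Y" for Y
      using r0 by (simp add: field_simps power2_eq_square)
    ultimately show ?case unfolding X_def[symmetric] rr by (simp only:)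
  qed
  ultimately show ?thesis using Lim_transform_eventually by fastforce
qed

theorem rogers_ramanujan_haupt:
  assumes s: "s > 0"
  shows "1 / rr5 s - 11 - rr5 s = 1 / haupt s"
proof -
  define G where "G = (\<lambda>s. (1 / rr5 s - 11 - rr5 s) * haupt s)"
  have "\<exists>c. \<forall>x\<in>{0<..}. G x = c"
  proof (rule has_field_derivative_zero_constant)
    show "(G has_real_derivative 0) (at x within {0<..})" if "x \<in> {0<..}" for x
      unfolding G_def by (rule has_field_derivative_at_within[OF haupt_rr5_deriv]) (use that in simp)
  qed simp
  then obtain c where c: "\<And>x. x > 0 \<Longrightarrow> G x = c" by auto
  have "\<forall>\<^sub>F x::real in at_top. G x = c"
    using eventually_gt_at_top[of 0] by eventually_elim (rule c)
  hence "(G \<longlongrightarrow> c) at_top" by (rule tendsto_eventually)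
  with haupt_rr5_tendsto have "c = 1" unfolding G_def[symmetric]
    using tendsto_unique trivial_limit_at_top_linorder by blast
  with c[OF s] show ?thesis using haupt_pos[OF s] unfolding G_def by (simp add: field_simps)
qed

section \<open>The Hauptmodul as a function of \<open>q\<close>\<close>

definition hauptq :: "real \<Rightarrow> real" where
  "hauptq q = q * (euler_prod (q ^ 5) / euler_prod q) ^ 6"

theorem hauptq_deriv:
  assumes q: "0 < q" "q < 1"
  shows "(hauptq has_real_derivative
      euler_prod (q ^ 5) ^ 5 / euler_prod q * sqrt ((1 + 11 * hauptq q)\<^sup>2 + 4 * (hauptq q)\<^sup>2)) (at q)"
proof -
  define s where "s = - ln q / 8"
  have s: "s > 0" using q by (simp add: s_def)
  have qs: "exp (- 8 * s) = q" using q by (simp add: s_def)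
  have hq: "haupt (- ln x / 8) = hauptq x" if "x \<in> {0<..<1}" for x
  proof -
    have "- ln x / 8 > 0" "exp (- 8 * (- ln x / 8)) = x" using that by auto
    thus ?thesis using haupt_q[of "- ln x / 8"] by (simp add: hauptq_def)
  qed
  define u v where "u = haupt s" and "v = rr5 s"
  have u: "u > 0" and v: "v > 0" using haupt_pos[OF s] rr5_pos[OF s] by (simp_all add: u_def v_def)
  have uq: "hauptq q = u" using hq[of q] q by (simp add: u_def s_def)
  have uv: "1 / v - v = 1 / u + 11"
    using rogers_ramanujan_haupt[OF s] by (simp add: u_def v_def)
  have "(1 / v + v)\<^sup>2 = (1 / v - v)\<^sup>2 + 4" using v by (simp add: field_simps power2_eq_square)
  hence "(u * (1 / v + v))\<^sup>2 = (u * (1 / u + 11))\<^sup>2 + 4 * u\<^sup>2"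
    unfolding uv by (simp only: power_mult_distrib) (simp only: distrib_left mult.commute[of 4])
  also have "u * (1 / u + 11) = 1 + 11 * u" using u by (simp add: field_simps)
  finally have sq: "u * (1 / v + v) = sqrt ((1 + 11 * u)\<^sup>2 + 4 * u\<^sup>2)"
    using u v by (intro real_sqrt_unique[symmetric]) simp_all
  have b: "eis_b s = eis_a s * v" using rr5_eis[OF s] by (simp add: v_def)
  have "(eis_a s)\<^sup>2 + (eis_b s)\<^sup>2 = (eis_a s * eis_b s) * (1 / v + v)"
    unfolding b using v by (simp add: field_simps power2_eq_square)
  also have "\<dots> = 4 * (q * euler_prod (q ^ 5) ^ 5 / euler_prod q) * (1 / v + v)"
    using eis_ab_q[OF s] unfolding qs by simp
  finally have ab: "(eis_a s)\<^sup>2 + (eis_b s)\<^sup>2 = 4 * (q * euler_prod (q ^ 5) ^ 5 / euler_prod q) * (1 / v + v)" .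
  \<comment> \<open>The factors \<open>- 2\<close> and \<open>- 1 / (8 * q)\<close> combine to
    \<open>1 / (4 * q)\<close>, which cancels the \<open>4 * q\<close> in \<open>ab\<close>.\<close>
  have "((\<lambda>x. haupt (- ln x / 8)) has_real_derivative
      haupt s * (- 2 * ((eis_a s)\<^sup>2 + (eis_b s)\<^sup>2)) * (- 1 / (8 * q))) (at q)"
  proof (rule DERIV_chain2[where f = haupt and g = "\<lambda>x. - ln x / 8"])
    show "(haupt has_real_derivative haupt s * (- 2 * ((eis_a s)\<^sup>2 + (eis_b s)\<^sup>2))) (at (- ln q / 8))"
      using haupt_deriv[OF s] unfolding s_def .
    show "((\<lambda>x. - ln x / 8) has_real_derivative - 1 / (8 * q)) (at q)"
      by (rule DERIV_cong, (rule derivative_eq_intros refl | (use q in simp))+)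
  qed
  also have "haupt s * (- 2 * ((eis_a s)\<^sup>2 + (eis_b s)\<^sup>2)) * (- 1 / (8 * q))
      = euler_prod (q ^ 5) ^ 5 / euler_prod q * (u * (1 / v + v))"
    unfolding ab u_def[symmetric] using q euler_prod_pos[OF q] by (simp add: field_simps)
  finally have "((\<lambda>x. haupt (- ln x / 8)) has_real_derivative
      euler_prod (q ^ 5) ^ 5 / euler_prod q * (u * (1 / v + v))) (at q)" .
  hence "(hauptq has_real_derivative euler_prod (q ^ 5) ^ 5 / euler_prod q * (u * (1 / v + v))) (at q)"
    by (rule has_field_derivative_transform_within_open[where S = "{0<..<1}"]) (use q hq in auto)
  thus ?thesis unfolding sq uq .
qed

section \<open>An Euler type integral\<close>

lemma pochhammer_le_fact:
  fixes x :: real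
  assumes "0 < x" "x \<le> 1"
  shows "pochhammer x n \<le> fact n"
proof (induction n)
  case (Suc n)
  have "pochhammer x (Suc n) = pochhammer x n * (x + real n)" by (simp add: pochhammer_Suc)
  also have "\<dots> \<le> fact n * (1 + real n)"
    using assms Suc by (intro mult_mono) (auto intro: pochhammer_nonneg)
  finally show ?case by (simp add: mult.commute)
qed simp

lemma gbinomial_minus_half: "(- 1 / 2 :: real) gchoose j = (- 1) ^ j * (pochhammer (1 / 2) j / fact j)"
  by (simp add: gbinomial_pochhammer)

lemma abs_gbinomial_minus_half_le: "\<bar>(- 1 / 2 :: real) gchoose j\<bar> \<le> 1"
  using pochhammer_le_fact[of "1 / 2" j] pochhammer_nonneg[of "1 / 2 :: real" j]
  unfolding gbinomial_minus_half by (simp add: abs_mult power_abs)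

lemma Gamma_reflection_real:
  fixes x :: real
  shows "Gamma x * Gamma (1 - x) = pi / sin (pi * x)"
proof -
  have "complex_of_real (Gamma x * Gamma (1 - x)) = complex_of_real (pi / sin (pi * x))"
    using Gamma_reflection_complex[of "complex_of_real x"]
    by (simp add: Gamma_complex_of_real[symmetric] sin_of_real[symmetric])
  thus ?thesis using of_real_eq_iff by blast
qed

context
  fixes k :: real
  assumes k: "0 < k" "k < 1"
begin

private definition coef where "coef j = ((- 1 / 2 :: real) gchoose j) * (4 / 121) ^ j"
private definition wt where "wt w = w powr (- k) * (1 - w) powr (k - 1)"

private lemma abs_coef_le: "\<bar>coef j\<bar> \<le> (4 / 121) ^ j"
  using abs_gbinomial_minus_half_le[of j] by (simp add: coef_def abs_mult mult_left_le_one_le)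

text \<open>Duplication splits \<open>pochhammer (1 - k) (2 * j)\<close> into the two upper
  parameters and \<open>(2 j)!\<close> into \<open>4^j (1/2)_j j!\<close>, whose middle factor
  cancels the binomial coefficient. Reflection turns \<open>Gamma (1 - k) * Gamma k\<close> into the
  cosecant.\<close>

private lemma Beta_coef:
  "coef j * Beta (2 * real j + 1 - k) k = pi * csc (k * pi) *
     (pochhammer (1 / 2 - k / 2) j * pochhammer (1 - k / 2) j / pochhammer 1 j * ((- 4 / 121) ^ j / fact j))"
proof -
  have G: "Gamma (1 - k) > 0" using k by (intro Gamma_real_pos) auto
  have "1 - k \<notin> \<int>\<^sub>\<le>\<^sub>0" using k by (auto elim!: nonpos_Ints_cases)
  from pochhammer_Gamma[OF this, of "2 * j"]
  have "Gamma (2 * real j + 1 - k) = pochhammer (1 - k) (2 * j) * Gamma (1 - k)"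
    using G by (simp add: field_simps)
  also have "pochhammer (1 - k) (2 * j) = 2 ^ (2 * j) * pochhammer (1 / 2 - k / 2) j * pochhammer (1 - k / 2) j"
    using pochhammer_double[of "1 / 2 - k / 2" j] by simp
  finally have 1: "Gamma (2 * real j + 1 - k) =
      2 ^ (2 * j) * pochhammer (1 / 2 - k / 2) j * pochhammer (1 - k / 2) j * Gamma (1 - k)" .
  have 2: "Gamma (2 * real j + 1 - k + k) = 2 ^ (2 * j) * pochhammer (1 / 2) j * fact j"
    using Gamma_fact[of "2 * j", where 'a = real] by (simp add: fact_double add.commute)
  have 3: "Gamma (1 - k) * Gamma k = pi * csc (k * pi)"
    using Gamma_reflection_real[of k] by (simp add: csc_def mult.commute)
  have p: "pochhammer (1 / 2 :: real) j > 0" by (rule pochhammer_pos) simp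
  have 4: "(- 4 / 121 :: real) ^ j = (- 1) ^ j * (4 / 121) ^ j"
    by (simp add: power_mult_distrib[symmetric])
  have "coef j * Beta (2 * real j + 1 - k) k =
      (- 1) ^ j * (pochhammer (1 / 2) j / fact j) * (4 / 121) ^ j *
      (2 ^ (2 * j) * pochhammer (1 / 2 - k / 2) j * pochhammer (1 - k / 2) j * (Gamma (1 - k) * Gamma k)
       / (2 ^ (2 * j) * pochhammer (1 / 2) j * fact j))"
    unfolding coef_def gbinomial_minus_half Beta_def 1 2 by (simp add: mult_ac)
  also have "\<dots> = (Gamma (1 - k) * Gamma k) *
      (pochhammer (1 / 2 - k / 2) j * pochhammer (1 - k / 2) j / fact j * ((- 1) ^ j * (4 / 121) ^ j / fact j))"
    using p by (simp add: field_simps)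
  finally show ?thesis unfolding 3 4 by (simp add: pochhammer_fact)
qed

private lemma sums_Beta_coef:
  "(\<lambda>j. coef j * Beta (2 * real j + 1 - k) k) sums
     (pi * csc (k * pi) * hypergeo_2F1 (1 / 2 - k / 2) (1 - k / 2) 1 (- 4 / 121))"
proof -
  define h where "h = (\<lambda>j. pochhammer (1 / 2 - k / 2) j * pochhammer (1 - k / 2) j / pochhammer 1 j * ((- 4 / 121) ^ j / fact j))"
  have "summable h"
  proof (rule summable_comparison_test')
    show "summable (\<lambda>j. (4 / 121 :: real) ^ j)" by (rule summable_geometric) simp
    show "norm (h j) \<le> (4 / 121) ^ j" for j
    proof -
      have "pochhammer (1 / 2 - k / 2) j * pochhammer (1 - k / 2) j \<le> fact j * fact j"
        using k by (intro mult_mono pochhammer_le_fact pochhammer_nonneg) auto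
      moreover have "pochhammer (1 / 2 - k / 2) j * pochhammer (1 - k / 2) j \<ge> 0"
        using k by (intro mult_nonneg_nonneg pochhammer_nonneg) auto
      ultimately have "\<bar>pochhammer (1 / 2 - k / 2) j * pochhammer (1 - k / 2) j / (fact j * fact j)\<bar> \<le> 1"
        by simp
      hence "\<bar>pochhammer (1 / 2 - k / 2) j * pochhammer (1 - k / 2) j / (fact j * fact j)\<bar> * (4 / 121) ^ j \<le> 1 * (4 / 121) ^ j"
        by (rule mult_right_mono) simp
      moreover have "norm (h j) = \<bar>pochhammer (1 / 2 - k / 2) j * pochhammer (1 - k / 2) j / (fact j * fact j)\<bar> * (4 / 121) ^ j"
        by (simp add: h_def abs_mult power_abs pochhammer_fact)
      ultimately show ?thesis by simp
    qed
  qed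
  hence "h sums hypergeo_2F1 (1 / 2 - k / 2) (1 - k / 2) 1 (- 4 / 121)"
    unfolding hypergeo_2F1_eq_suminf h_def by (rule summable_sums)
  from sums_mult[OF this, of "pi * csc (k * pi)"] show ?thesis
    unfolding Beta_coef h_def .
qed

private lemma has_integral_wt_power:
  "((\<lambda>w. w ^ (2 * j) * wt w) has_integral Beta (2 * real j + 1 - k) k) {0<..<1}"
proof -
  have "((\<lambda>w. w powr (2 * real j + 1 - k - 1) * (1 - w) powr (k - 1)) has_integral Beta (2 * real j + 1 - k) k) {0<..<1}"
    using has_integral_Beta_real[of "2 * real j + 1 - k" k] k by (simp add: has_integral_Icc_iff_Ioo)
  thus ?thesis
  proof (rule has_integral_eq[rotated])
    fix w :: real assume "w \<in> {0<..<1}"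
    hence "w > 0" by simp
    hence "w powr (2 * real j + 1 - k - 1) = w ^ (2 * j) * w powr (- k)"
      by (simp add: powr_realpow[symmetric] powr_add[symmetric])
    thus "w powr (2 * real j + 1 - k - 1) * (1 - w) powr (k - 1) = w ^ (2 * j) * wt w"
      by (simp add: wt_def)
  qed
qed

theorem euler_type_integral:
  "((\<lambda>w. w powr (- k) * (1 - w) powr (k - 1) * (1 + 4 / 121 * w\<^sup>2) powr (- 1 / 2)) has_integral
     pi * csc (k * pi) * hypergeo_2F1 (1 / 2 - k / 2) (1 - k / 2) 1 (- 4 / 121)) {0<..<1}"
proof (rule has_integral_dominated_convergence)
  show "((\<lambda>w. \<Sum>j<n. coef j * (w ^ (2 * j) * wt w)) has_integral
          (\<Sum>j<n. coef j * Beta (2 * real j + 1 - k) k)) {0<..<1}" for n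
    by (intro has_integral_sum has_integral_mult_right has_integral_wt_power) auto
  \<comment> \<open>As \<open>w < 1\<close>, the coefficients are dominated by the geometric series
    with ratio 4/121, whose sum 121/117 is below 2.\<close>
  show "(\<lambda>w. 2 * wt w) integrable_on {0<..<1}"
    using has_integral_integrable[OF has_integral_mult_right[OF has_integral_wt_power[of 0], of 2]] by simp
  show "(\<lambda>n. \<Sum>j<n. coef j * Beta (2 * real j + 1 - k) k) \<longlonglongrightarrow>
      pi * csc (k * pi) * hypergeo_2F1 (1 / 2 - k / 2) (1 - k / 2) 1 (- 4 / 121)"
    using sums_Beta_coef by (simp add: sums_def)
  show "\<forall>w\<in>{0<..<1}. norm (\<Sum>j<n. coef j * (w ^ (2 * j) * wt w)) \<le> 2 * wt w" for n
  proof
    fix w :: real assume w: "w \<in> {0<..<1}"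
    have wt: "wt w \<ge> 0" by (simp add: wt_def)
    have "norm (\<Sum>j<n. coef j * (w ^ (2 * j) * wt w)) \<le> (\<Sum>j<n. (4 / 121) ^ j * wt w)"
    proof (rule sum_norm_le)
      fix j
      have "\<bar>coef j\<bar> * w ^ (2 * j) \<le> (4 / 121) ^ j * 1"
        using w by (intro mult_mono abs_coef_le power_le_one) auto
      thus "norm (coef j * (w ^ (2 * j) * wt w)) \<le> (4 / 121) ^ j * wt w"
        using w wt mult_right_mono[OF _ wt] by (simp add: abs_mult mult.assoc[symmetric])
    qed
    also have "\<dots> = (\<Sum>j<n. (4 / 121) ^ j) * wt w" by (simp add: sum_distrib_right)
    also have "\<dots> \<le> 2 * wt w"
    proof (rule mult_right_mono[OF _ wt])
      have "(\<Sum>j<n. (4 / 121 :: real) ^ j) = (1 - (4 / 121) ^ n) / (1 - 4 / 121)"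
        by (subst sum_gp_strict) auto
      moreover have "(1 - P) / (1 - 4 / 121) \<le> 2" if "P \<ge> 0" for P :: real
        using that by simp
      ultimately show "(\<Sum>j<n. (4 / 121 :: real) ^ j) \<le> 2"
        by (metis zero_le_power divide_nonneg_nonneg zero_le_numeral)
    qed
    finally show "norm (\<Sum>j<n. coef j * (w ^ (2 * j) * wt w)) \<le> 2 * wt w" .
  qed
  show "\<forall>w\<in>{0<..<1}. (\<lambda>n. \<Sum>j<n. coef j * (w ^ (2 * j) * wt w)) \<longlonglongrightarrow>
      w powr (- k) * (1 - w) powr (k - 1) * (1 + 4 / 121 * w\<^sup>2) powr (- 1 / 2)"
  proof
    fix w :: real assume w: "w \<in> {0<..<1}"
    hence "w\<^sup>2 < 1" by (simp add: power_less_one_iff)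
    hence "\<bar>4 / 121 * w\<^sup>2\<bar> < 1" by simp
    from sums_mult2[OF gen_binomial_real[OF this, of "- 1 / 2"], of "wt w"]
    have "(\<lambda>j. ((- 1 / 2) gchoose j) * (4 / 121 * w\<^sup>2) ^ j * wt w) sums
        ((1 + 4 / 121 * w\<^sup>2) powr (- 1 / 2) * wt w)" .
    moreover have "((- 1 / 2) gchoose j) * (4 / 121 * w\<^sup>2) ^ j * wt w = coef j * (w ^ (2 * j) * wt w)" for j
      unfolding coef_def power_mult_distrib power_mult[of w 2] by (simp only: mult_ac)
    ultimately have "(\<lambda>j. coef j * (w ^ (2 * j) * wt w)) sums ((1 + 4 / 121 * w\<^sup>2) powr (- 1 / 2) * wt w)"
      by (simp only:)
    thus "(\<lambda>n. \<Sum>j<n. coef j * (w ^ (2 * j) * wt w)) \<longlonglongrightarrow>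
      w powr (- k) * (1 - w) powr (k - 1) * (1 + 4 / 121 * w\<^sup>2) powr (- 1 / 2)"
      by (simp add: sums_def wt_def mult_ac)
  qed
qed

end

section \<open>The change of variables\<close>

lemma hauptq_pos: "0 < q \<Longrightarrow> q < 1 \<Longrightarrow> 0 < hauptq q"
  unfolding hauptq_def by (intro mult_pos_pos zero_less_power divide_pos_pos euler_prod_pos)
    (auto simp: power_less_one_iff)

text \<open>The factors of the quotient are \<open>1 + x + x^2 + x^3 + x^4\<close> with
  \<open>x = q ^ Suc i\<close>, hence at least 1, and partial products bound the limit from below.
  Each factor tends to 5 as \<open>q\<close> tends to 1, so the quotient is unbounded there.\<close>

lemma euler_prod_ratio_ge:
  assumes q: "0 < q" "q < 1"
  shows "(\<Prod>i<n. \<Sum>j<5. (q ^ Suc i) ^ j) \<le> euler_prod (q ^ 5) / euler_prod q"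
proof -
  have q5: "0 < q ^ 5" "q ^ 5 < 1" using q by (auto simp: power_less_one_iff)
  define r where "r = (\<lambda>n. \<Prod>i<n. \<Sum>j<5. (q ^ Suc i) ^ j)"
  have r: "qfact (q ^ 5) n / qfact q n = r n" for n
  proof -
    have "(1 - (q ^ 5) ^ Suc i) / (1 - q ^ Suc i) = (\<Sum>j<5. (q ^ Suc i) ^ j)" for i
    proof -
      have "(q ^ 5) ^ Suc i = (q ^ Suc i) ^ 5" by (simp only: power_mult[symmetric] mult.commute)
      moreover have "1 - q ^ Suc i > 0" by (rule one_minus_power_bounds[OF q])
      ultimately show ?thesis by (subst sum_gp_strict) auto
    qed
    thus ?thesis unfolding qfact_def r_def by (simp add: prod_dividef[symmetric] del: power_Suc)
  qed
  have "r \<longlonglongrightarrow> euler_prod (q ^ 5) / euler_prod q"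
    unfolding r[symmetric, abs_def]
    using euler_prod_pos[OF q] by (intro tendsto_divide qfact_tendsto q q5) auto
  moreover have "incseq r"
  proof (rule incseq_SucI)
    fix m
    have "r m * 1 \<le> r m * (\<Sum>j<5. (q ^ Suc m) ^ j)"
    proof (rule mult_left_mono)
      show "0 \<le> r m" unfolding r_def using q by (intro prod_nonneg ballI sum_nonneg) auto
      have "(\<Sum>j\<in>{0}. (q ^ Suc m) ^ j) \<le> (\<Sum>j<5. (q ^ Suc m) ^ j)"
        using q by (intro sum_mono2) auto
      thus "1 \<le> (\<Sum>j<5. (q ^ Suc m) ^ j)" by simp
    qed
    thus "r m \<le> r (Suc m)" by (simp add: r_def)
  qed
  ultimately have "r n \<le> euler_prod (q ^ 5) / euler_prod q" by (rule incseq_le[rotated])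
  thus ?thesis unfolding r_def .
qed

lemma hauptq_image: "hauptq ` {0<..<1} = {0<..}"
proof (intro equalityI subsetI)
  fix t :: real assume "t \<in> {0<..}"
  hence t: "t > 0" by simp
  have "\<forall>\<^sub>F q in at_right 0. hauptq q < t"
  proof (rule order_tendstoD(2)[OF _ t])
    have "filterlim (\<lambda>q::real. q ^ 5) (at_right 0) (at_right 0)" by real_asymp
    from filterlim_compose[OF euler_prod_tendsto_1 this]
    have "((\<lambda>q. q * (euler_prod (q ^ 5) / euler_prod q) ^ 6) \<longlongrightarrow> 0 * (1 / 1) ^ 6) (at_right 0)"
      by (intro tendsto_intros euler_prod_tendsto_1) auto
    thus "(hauptq \<longlongrightarrow> 0) (at_right 0)" by (simp add: hauptq_def[abs_def])
  qed
  hence "\<forall>\<^sub>F q in at_right 0. hauptq q < t \<and> q \<in> {0<..<1}"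
    using eventually_at_right_real[of 0 1] by (intro eventually_conj) auto
  then obtain q1 where q1: "hauptq q1 < t" "q1 \<in> {0<..<1}"
    using eventually_happens by force
  obtain n where n: "t < 5 ^ n" using real_arch_pow[of 5 t] by auto
  \<comment> \<open>A minorant of \<open>hauptq\<close> that, as a polynomial in \<open>q\<close>,
    is continuous at 1, with value \<open>5 ^ (6 * n)\<close> exceeding \<open>t\<close>.\<close>
  define P where "P = (\<lambda>q::real. q * (\<Prod>i<n. \<Sum>j<5. (q ^ Suc i) ^ j) ^ 6)"
  have "\<forall>\<^sub>F q in at_left 1. t < P q"
  proof (rule order_tendstoD(1))
    have "isCont P 1" unfolding P_def by (intro continuous_intros)
    hence "(P \<longlongrightarrow> P 1) (at_left 1)"
      unfolding isCont_def by (rule filterlim_mono) (auto simp: at_le)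
    moreover have "P 1 = (5 ^ n) ^ 6" by (simp add: P_def)
    ultimately show "(P \<longlongrightarrow> (5 ^ n) ^ 6) (at_left 1)" by simp
    have "(5 ^ n) ^ 1 \<le> ((5 ^ n) ^ 6 :: real)" by (rule power_increasing) auto
    thus "t < (5 ^ n) ^ 6" using n by simp
  qed
  hence "\<forall>\<^sub>F q in at_left 1. t < P q \<and> q \<in> {0<..<1}"
    using eventually_at_left_real[of 0 1] by (intro eventually_conj) auto
  then obtain q2 where q2: "t < P q2" "q2 \<in> {0<..<1}"
    using eventually_happens by force
  have "P q2 \<le> hauptq q2"
    unfolding P_def hauptq_def using q2(2)
    by (intro mult_left_mono power_mono euler_prod_ratio_ge prod_nonneg ballI sum_nonneg) auto
  with q2 have q2': "t < hauptq q2" by simp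
  have "continuous_on {0<..<1} hauptq"
    by (intro continuous_at_imp_continuous_on ballI DERIV_isCont[OF hauptq_deriv]) auto
  hence "connected (hauptq ` {0<..<1})"
    by (rule connected_continuous_image) (simp add: convex_connected)
  from connected_contains_Icc[OF this, of "hauptq q1" "hauptq q2"] q1 q2 q2'
  show "t \<in> hauptq ` {0<..<1}" by auto
qed (use hauptq_pos in auto)

definition unitq :: "real \<Rightarrow> real" where
  "unitq q = 11 * hauptq q / (1 + 11 * hauptq q)"

definition unitq' :: "real \<Rightarrow> real" where
  "unitq' q = 11 * (euler_prod (q ^ 5) ^ 5 / euler_prod q * sqrt ((1 + 11 * hauptq q)\<^sup>2 + 4 * (hauptq q)\<^sup>2))
     / (1 + 11 * hauptq q)\<^sup>2"

lemma unitq_deriv: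
  assumes q: "0 < q" "q < 1"
  shows "(unitq has_real_derivative unitq' q) (at q)"
proof -
  define d where "d = euler_prod (q ^ 5) ^ 5 / euler_prod q * sqrt ((1 + 11 * hauptq q)\<^sup>2 + 4 * (hauptq q)\<^sup>2)"
  have "1 + 11 * hauptq q \<noteq> 0" using hauptq_pos[OF q] by simp
  hence "(unitq has_real_derivative 11 * d / (1 + 11 * hauptq q)\<^sup>2) (at q)"
    unfolding unitq_def[abs_def]
    by (intro DERIV_cong[OF DERIV_divide[OF DERIV_cmult[OF hauptq_deriv[OF q, folded d_def]]
          DERIV_add[OF DERIV_const DERIV_cmult[OF hauptq_deriv[OF q, folded d_def]]]]])
       (simp_all add: field_simps power2_eq_square)
  thus ?thesis by (simp only: unitq'_def d_def)
qed

lemma unitq'_pos: 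
  assumes q: "0 < q" "q < 1"
  shows "0 < unitq' q"
proof -
  have q5: "0 < q ^ 5" "q ^ 5 < 1" using q by (auto simp: power_less_one_iff)
  have "(1 + 11 * hauptq q)\<^sup>2 + 4 * (hauptq q)\<^sup>2 > 0"
    using hauptq_pos[OF q] by (intro add_pos_pos) auto
  thus ?thesis unfolding unitq'_def
    using euler_prod_pos[OF q] euler_prod_pos[OF q5] hauptq_pos[OF q] by simp
qed

lemma unitq_inj: "inj_on unitq {0<..<1}"
proof (rule strict_mono_on_imp_inj_on, rule strict_mono_onI)
  fix x y :: real assume xy: "x \<in> {0<..<1}" "y \<in> {0<..<1}" "x < y"
  show "unitq x < unitq y"
  proof (rule DERIV_pos_imp_increasing[OF xy(3)])
    fix z assume "x \<le> z" "z \<le> y"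
    hence "0 < z" "z < 1" using xy by auto
    thus "\<exists>d. (unitq has_real_derivative d) (at z) \<and> 0 < d"
      using unitq_deriv unitq'_pos by blast
  qed
qed

lemma unitq_image: "unitq ` {0<..<1} = {0<..<1}"
proof -
  have "unitq ` {0<..<1} = (\<lambda>u. 11 * u / (1 + 11 * u)) ` hauptq ` {0<..<1}"
    by (auto simp: unitq_def image_image)
  also have "\<dots> = (\<lambda>u. 11 * u / (1 + 11 * u)) ` {0<..}" by (simp only: hauptq_image)
  also have "\<dots> = {0<..<1}"
  proof (intro equalityI subsetI)
    fix w :: real assume "w \<in> {0<..<1}"
    hence w: "0 < w" "w < 1" by auto
    have "w = 11 * (w / (11 * (1 - w))) / (1 + 11 * (w / (11 * (1 - w))))"
      using w by (simp add: field_simps)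
    moreover have "w / (11 * (1 - w)) \<in> {0<..}" using w by simp
    ultimately show "w \<in> (\<lambda>u. 11 * u / (1 + 11 * u)) ` {0<..}" by blast
  qed auto
  finally show ?thesis .
qed

text \<open>With \<open>D = 1 + 11 U\<close> the exponents of \<open>D\<close> add up to
  \<open>-2 + k + (1 - k) + 1 = 0\<close> and those of 11 to \<open>1 + (k - 1) - k = 0\<close>,
  which accounts for the factor \<open>11 powr (k - 1)\<close>. The fourth power arises from
  \<open>F^5 / E = (F / E)^5 E^4\<close>.\<close>

lemma integrand_eq:
  fixes k :: real
  assumes q: "0 < q" "q < 1"
  shows "\<bar>unitq' q\<bar> * (11 powr (k - 1) * (unitq q powr (- k) * (1 - unitq q) powr (k - 1)
             * (1 + 4 / 121 * (unitq q)\<^sup>2) powr (- 1 / 2)))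
       = (euler_prod (q ^ 5) / euler_prod q) powr (- 6 * k + 5) * euler_prod q ^ 4 * q powr (- k)"
proof -
  have q5: "0 < q ^ 5" "q ^ 5 < 1" using q by (auto simp: power_less_one_iff)
  define E F U D R where "E = euler_prod q" and "F = euler_prod (q ^ 5)" and "U = hauptq q"
    and "D = 1 + 11 * U" and "R = sqrt (D\<^sup>2 + 4 * U\<^sup>2)"
  have E: "E > 0" and F: "F > 0" using euler_prod_pos[OF q] euler_prod_pos[OF q5] by (simp_all add: E_def F_def)
  have U: "U > 0" using hauptq_pos[OF q] by (simp add: U_def)
  have D: "D > 0" using U by (simp add: D_def)
  have pos: "D\<^sup>2 + 4 * U\<^sup>2 > 0" using U D by (intro add_pos_pos) auto
  have R: "R > 0" using pos by (simp add: R_def)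
  have w: "unitq q = 11 * U / D" by (simp add: unitq_def D_def U_def)
  have w1: "1 - unitq q = 1 / D" unfolding w using D by (simp add: field_simps D_def)
  have 1: "unitq q powr (- k) = 11 powr (- k) * U powr (- k) * D powr k"
    unfolding w using U D by (simp add: powr_divide powr_mult powr_minus field_simps)
  have 2: "(1 - unitq q) powr (k - 1) = D powr (1 - k)"
    unfolding w1 using D by (simp add: powr_divide powr_minus_divide[symmetric])
  have "1 + 4 / 121 * (unitq q)\<^sup>2 = (D\<^sup>2 + 4 * U\<^sup>2) / D\<^sup>2"
    unfolding w using D by (simp add: field_simps power2_eq_square)
  hence "(1 + 4 / 121 * (unitq q)\<^sup>2) powr (1 / 2) = R / D"
    using pos D by (simp add: powr_half_sqrt real_sqrt_divide R_def)
  hence 3: "(1 + 4 / 121 * (unitq q)\<^sup>2) powr (- 1 / 2) = D / R"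
    using powr_minus_divide[of "1 + 4 / 121 * (unitq q)\<^sup>2" "1 / 2"] by simp
  have 4: "\<bar>unitq' q\<bar> = 11 * (F ^ 5 / E * R) / D\<^sup>2"
    unfolding abs_of_pos[OF unitq'_pos[OF q]] by (simp only: unitq'_def E_def F_def U_def D_def R_def)
  have 5: "D powr k * D powr (1 - k) = D" using D by (simp add: powr_add[symmetric])
  have 6: "11 powr (k - 1) * 11 powr (- k) = (1 / 11 :: real)"
    unfolding powr_add[symmetric] by (simp add: powr_neg_one)
  have "\<bar>unitq' q\<bar> * (11 powr (k - 1) * (unitq q powr (- k) * (1 - unitq q) powr (k - 1)
             * (1 + 4 / 121 * (unitq q)\<^sup>2) powr (- 1 / 2)))
     = 11 * (F ^ 5 / E * R) / D\<^sup>2 * ((11 powr (k - 1) * 11 powr (- k)) * U powr (- k) * (D powr k * D powr (1 - k)) * (D / R))"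
    unfolding 1 2 3 4 by (simp only: mult_ac)
  also have "\<dots> = F ^ 5 / E * U powr (- k)"
    unfolding 5 6 using D R by (simp add: power2_eq_square)
  also have "U powr (- k) = q powr (- k) * (F / E) powr (- 6 * k)"
  proof -
    have "U = q * (F / E) powr 6"
      unfolding U_def hauptq_def E_def[symmetric] F_def[symmetric] using E F by (simp add: powr_numeral)
    moreover have "((F / E) powr 6) powr (- k) = (F / E) powr (- 6 * k)" by (simp only: powr_powr) simp
    ultimately show ?thesis using q by (simp only: powr_mult)
  qed
  also have "F ^ 5 / E = (F / E) powr 5 * E ^ 4"
    using E F by (simp add: powr_numeral power_divide field_simps eval_nat_numeral)
  also have "(F / E) powr 5 * E ^ 4 * (q powr (- k) * (F / E) powr (- 6 * k))
      = (F / E) powr (- 6 * k + 5) * E ^ 4 * q powr (- k)"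
    unfolding powr_add by (simp only: mult_ac)
  finally show ?thesis unfolding E_def F_def .
qed

lemma ramanujan_f_minus_eq: "ramanujan_f (- q) = euler_prod q"
  by (simp add: ramanujan_f_minus euler_prod_def)

theorem theorem5:
  fixes k :: real
  assumes "0 < k" and "k < 1"
  shows "((\<lambda>q::real. (ramanujan_f (- (q ^ 5)) / ramanujan_f (- q)) powr (- 6 * k + 5)
              * ramanujan_f (- q) ^ 4 * q powr (- k))
           has_integral
           (11 powr (k - 1) * pi * csc (k * pi)
              * hypergeo_2F1 (1 / 2 - k / 2) (1 - k / 2) 1 (- 4 / 121)))
         {0<..<1}"
proof -
  define f where "f = (\<lambda>w::real. 11 powr (k - 1) * (w powr (- k) * (1 - w) powr (k - 1)
      * (1 + 4 / 121 * w\<^sup>2) powr (- 1 / 2)))"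
  define I where "I = 11 powr (k - 1) * (pi * csc (k * pi) * hypergeo_2F1 (1 / 2 - k / 2) (1 - k / 2) 1 (- 4 / 121))"
  have f: "(f has_integral I) {0<..<1}"
    unfolding f_def I_def by (intro has_integral_mult_right euler_type_integral assms)
  \<comment> \<open>The substitution theorem concerns absolutely integrable functions; here absolute
    integrability follows from \<open>f\<close> being nonnegative.\<close>
  have "f absolutely_integrable_on {0<..<1}"
    by (rule nonnegative_absolutely_integrable_1[OF has_integral_integrable[OF f]])
       (simp add: f_def)
  hence "f absolutely_integrable_on (unitq ` {0<..<1}) \<and> integral (unitq ` {0<..<1}) f = I"
    unfolding unitq_image using integral_unique[OF f] by blast
  hence "(\<lambda>q. \<bar>unitq' q\<bar> * f (unitq q)) absolutely_integrable_on {0<..<1} \<and>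
      integral {0<..<1} (\<lambda>q. \<bar>unitq' q\<bar> * f (unitq q)) = I"
    by (subst has_absolute_integral_change_of_variables_1'[OF _ _ unitq_inj])
       (auto intro: has_field_derivative_at_within unitq_deriv)
  hence "((\<lambda>q. \<bar>unitq' q\<bar> * f (unitq q)) has_integral I) {0<..<1}"
    using set_lebesgue_integral_eq_integral(1) has_integral_integrable_integral by blast
  hence "((\<lambda>q::real. (ramanujan_f (- (q ^ 5)) / ramanujan_f (- q)) powr (- 6 * k + 5)
              * ramanujan_f (- q) ^ 4 * q powr (- k)) has_integral I) {0<..<1}"
  proof (rule has_integral_eq[rotated])
    fix q :: real assume "q \<in> {0<..<1}"
    hence "0 < q" "q < 1" by auto
    from integrand_eq[OF this, of k]
    show "\<bar>unitq' q\<bar> * f (unitq q) = (ramanujan_f (- (q ^ 5)) / ramanujan_f (- q)) powr (- 6 * k + 5)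
              * ramanujan_f (- q) ^ 4 * q powr (- k)"
      unfolding f_def ramanujan_f_minus_eq .
  qed
  thus ?thesis by (simp add: I_def mult_ac)
qed

end
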